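(* Let $T,\Omega\subseteq\mathbb{R}^d$ be measurable and let $f\in L^1(\mathbb{R}^d)$ with $\widehat f\in L^1(\mathbb{R}^d)$, $f\ne0$. Suppose $f$ is $\varepsilon_T$-concentrated on $T$ and $\widehat f$ is $\varepsilon_\Omega$-concentrated on $\Omega$, where $0\le\varepsilon_T,\varepsilon_\Omega\le1$ and $\varepsilon_T+\varepsilon_\Omega\le1$. Then \[ |T|\,|\Omega|\ge C_f\,(1-\varepsilon_T-\varepsilon_\Omega)^2, \] where $C_f$ is the supremum, over $\bar t,\bar\omega\in\mathbb{R}^d$, $q_1,q_2\in(1,\infty]$ and $\alpha_j>d/q_j'$ ($j=1,2$), of \[ \frac{\|f\|_2^4\,\|\widehat f\|_{q_1}^{2d/(\alpha_1q_1')}\,\|f\|_{q_2}^{2d/(\alpha_2q_2')}}{K(d,\alpha_1,q_1)K(d,\alpha_2,q_2)\,\|f\|_{q_2}^2\,\|\widehat f\|_{q_1}^2\,\big\||t-\bar t|^{\alpha_2}f\big\|_{q_2}^{2d/(\alpha_2q_2')}\,\big\||\omega-\bar\omega|^{\alpha_1}\widehat f\big\|_{q_1}^{2d/(\alpha_1q_1')}} \] (with the convention that the quotient is $0$ when a norm in the denominator is infinite).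
   Context: Fourier transform $\widehat f(\omega)=\int e^{-2\pi i x\cdot\omega}f(x)\,dx$; $\frac1q+\frac1{q'}=1$; $|\cdot|$ is Lebesgue measure. For $\varepsilon\ge0$, $f\in L^2(\mathbb{R}^d)$ is $\varepsilon$-concentrated on a measurable set $U$ if $\big(\int_{\mathbb{R}^d\setminus U}|f|^2\big)^{1/2}\le\varepsilon\|f\|_2$. $K(d,\alpha,q)=\tilde K^2$ where, for $q\in(1,\infty)$, $\alpha>d/q'$, $\tilde K=\big[\frac{2\pi^{d/2}}{\Gamma(d/2)}\frac{1}{\alpha q}B\big(\frac{d}{\alpha q},\frac{1}{q-1}-\frac{d}{\alpha q}\big)\big]^{\frac{q-1}{q}}\big(\frac{\alpha q'}{d}-1\big)^{d/(qq'\alpha)}\big(1-\frac{d}{\alpha q'}\big)^{-1/q}$, and for $q=\infty$, $\tilde K=\frac{2\pi^{d/2}}{\Gamma(d/2)}\frac{\alpha}{d(\alpha-d)}$; $\Gamma$ is the Gamma function and $B$ the Beta function. *)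

theory Defs
  imports "HOL-Analysis.Analysis"
begin

definition fourier :: "('a::euclidean_space \<Rightarrow> complex) \<Rightarrow> 'a \<Rightarrow> complex" where
  "fourier f w = (LINT x|lebesgue. exp (- (2 * pi * \<i>) * complex_of_real (x \<bullet> w)) * f x)"

definition Lqnorm :: "ereal \<Rightarrow> ('a::euclidean_space \<Rightarrow> complex) \<Rightarrow> ennreal" where
  "Lqnorm q f =
     (if q = \<infinity> then Inf {C. AE x in lebesgue. ennreal (norm (f x)) \<le> C}
      else (let I = (\<integral>\<^sup>+ x. ennreal (norm (f x) powr real_of_ereal q) \<partial>lebesgue)
            in if I = \<infinity> then \<infinity> else ennreal (enn2real I powr (1 / real_of_ereal q))))"

definition eps_concentrated :: "real \<Rightarrow> 'a set \<Rightarrow> ('a::euclidean_space \<Rightarrow> complex) \<Rightarrow> bool" where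
  "eps_concentrated eps U f \<longleftrightarrow>
     f \<in> borel_measurable lebesgue \<and> Lqnorm 2 f < \<infinity> \<and>
     Lqnorm 2 (\<lambda>x. indicator (- U) x * f x) \<le> ennreal eps * Lqnorm 2 f"

definition conj_exp :: "ereal \<Rightarrow> real" where
  "conj_exp q = (if q = \<infinity> then 1 else real_of_ereal q / (real_of_ereal q - 1))"

definition Ktilde :: "nat \<Rightarrow> real \<Rightarrow> ereal \<Rightarrow> real" where
  "Ktilde d \<alpha> q =
    (if q = \<infinity> then 2 * pi powr (real d / 2) / Gamma (real d / 2) * (\<alpha> / (real d * (\<alpha> - real d)))
     else (let r = real_of_ereal q; r' = conj_exp q in
       (2 * pi powr (real d / 2) / Gamma (real d / 2) * (1 / (\<alpha> * r))
          * Beta (real d / (\<alpha> * r)) (1 / (r - 1) - real d / (\<alpha> * r))) powr ((r - 1) / r)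
       * (\<alpha> * r' / real d - 1) powr (real d / (r * r' * \<alpha>))
       * (1 - real d / (\<alpha> * r')) powr (- 1 / r)))"

definition K :: "nat \<Rightarrow> real \<Rightarrow> ereal \<Rightarrow> real" where
  "K d \<alpha> q = (Ktilde d \<alpha> q)\<^sup>2"

definition Cf_quot :: "('a::euclidean_space \<Rightarrow> complex) \<Rightarrow> 'a \<Rightarrow> 'a \<Rightarrow> ereal \<Rightarrow> ereal \<Rightarrow> real \<Rightarrow> real \<Rightarrow> ennreal" where
  "Cf_quot f tb wb q1 q2 a1 a2 =
    (let d = DIM('a);
         e1 = 2 * real d / (a1 * conj_exp q1);
         e2 = 2 * real d / (a2 * conj_exp q2);
         N2 = Lqnorm 2 f;
         Nh1 = Lqnorm q1 (fourier f);
         Nf2 = Lqnorm q2 f;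
         W2 = Lqnorm q2 (\<lambda>t. complex_of_real (norm (t - tb) powr a2) * f t);
         W1 = Lqnorm q1 (\<lambda>w. complex_of_real (norm (w - wb) powr a1) * fourier f w)
     in if Nh1 = \<infinity> \<or> Nf2 = \<infinity> \<or> W1 = \<infinity> \<or> W2 = \<infinity> then 0
        else ennreal ((enn2real N2 ^ 4 * enn2real Nh1 powr e1 * enn2real Nf2 powr e2) /
                (K d a1 q1 * K d a2 q2 * (enn2real Nf2)\<^sup>2 * (enn2real Nh1)\<^sup>2
                  * enn2real W2 powr e2 * enn2real W1 powr e1)))"

definition C_f :: "('a::euclidean_space \<Rightarrow> complex) \<Rightarrow> ennreal" where
  "C_f f = (SUP (tb, wb, q1, q2, a1, a2) \<in>
              {(tb, wb, q1, q2, a1, a2). 1 < q1 \<and> 1 < q2 \<and>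
                  a1 > real DIM('a) / conj_exp q1 \<and> a2 > real DIM('a) / conj_exp q2}.
              Cf_quot f tb wb q1 q2 a1 a2)"

end

theory Submission
  imports Defs "HOL-Probability.Characteristic_Functions"
begin

text \<open>
  Fourier inversion gives \<open>|f| \<le> \<parallel>f^\<parallel>\<^sub>1\<close> almost everywhere, and \<open>|f^| \<le> \<parallel>f\<parallel>\<^sub>1\<close>. Concentration
  on \<open>T\<close> then yields \<open>(1 - \<epsilon>\<^sub>T\<^sup>2) \<parallel>f\<parallel>\<^sub>2\<^sup>2 \<le> |T| \<parallel>f^\<parallel>\<^sub>1\<^sup>2\<close>, and symmetrically for \<open>\<Omega>\<close> by
  Plancherel; multiplying, \<open>|T| |\<Omega>| \<ge> (1 - \<epsilon>\<^sub>T - \<epsilon>\<^sub>\<Omega>)\<^sup>2 \<parallel>f\<parallel>\<^sub>2\<^sup>4 / (\<parallel>f\<parallel>\<^sub>1\<^sup>2 \<parallel>f^\<parallel>\<^sub>1\<^sup>2)\<close>. The quotients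
  defining \<open>C_f\<close> arise by bounding both \<open>L\<^sup>1\<close> norms through the Carlson-type inequality
  \<open>\<parallel>f\<parallel>\<^sub>1 \<le> Ktilde * \<parallel>f\<parallel>\<^sub>q powr (1 - \<theta>) * \<parallel>|x - x0| powr \<alpha> f\<parallel>\<^sub>q powr \<theta>\<close> with \<open>\<theta> = d / (\<alpha> q')\<close>. For
  \<open>q < \<infinity>\<close> this is Hoelder's inequality with the weight \<open>1 + l |x - x0| powr (\<alpha> q)\<close> and the optimal \<open>l\<close>;
  for \<open>q = \<infinity>\<close> it is the integral of the minimum of the two pointwise bounds.
\<close>

section \<open>Fourier inversion and Plancherel\<close>

text \<open>\<open>lborel_eq\<close> presents Lebesgue measure as the image of the product measure
  over \<open>Basis\<close> under recombination of coordinates, so Fubini for finite products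
  applies. This reduces the Gaussian integral below to one dimension.\<close>

lemma
  fixes f :: "'a::euclidean_space \<Rightarrow> real \<Rightarrow> complex"
  assumes f: "\<And>b. b \<in> Basis \<Longrightarrow> integrable lborel (f b)"
  shows integrable_lborel_prod: "integrable lborel (\<lambda>x. \<Prod>b\<in>Basis. f b (x \<bullet> b))"
    and integral_lborel_prod:
      "(LINT x|lborel. (\<Prod>b\<in>Basis. f b (x \<bullet> b))) = (\<Prod>b\<in>Basis. integral\<^sup>L lborel (f b))"
proof -
  interpret product_sigma_finite "\<lambda>_::'a. lborel :: real measure" ..
  have [measurable]: "f b \<in> borel_measurable borel" if "b \<in> Basis" for b
    using borel_measurable_integrable[OF f[OF that]] by simp
  have inner: "(\<Sum>c\<in>Basis. y c *\<^sub>R c) \<bullet> b = y b" if "b \<in> Basis" for b :: 'a and y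
    using that by (simp add: inner_sum_left inner_Basis if_distrib cong: if_cong)
  have eq: "(\<Prod>b\<in>Basis. f b ((\<Sum>c\<in>Basis. y c *\<^sub>R c) \<bullet> b)) = (\<Prod>b\<in>Basis. f b (y b))" for y
    by (intro prod.cong refl) (simp only: inner)
  have "integrable (Pi\<^sub>M Basis (\<lambda>_. lborel)) (\<lambda>y. (\<Prod>b\<in>Basis. f b (y b)))"
    by (rule product_integrable_prod) (use f in auto)
  then show "integrable lborel (\<lambda>x. \<Prod>b\<in>Basis. f b (x \<bullet> b))"
    by (subst lborel_eq) (simp add: integrable_distr_eq eq)
  have "(LINT x|lborel. (\<Prod>b\<in>Basis. f b (x \<bullet> b)))
      = (LINT y|Pi\<^sub>M Basis (\<lambda>_. lborel). (\<Prod>b\<in>Basis. f b (y b)))"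
    by (subst lborel_eq) (simp add: integral_distr eq)
  also have "\<dots> = (\<Prod>b\<in>Basis. integral\<^sup>L lborel (f b))"
    by (rule product_integral_prod) (use f in auto)
  finally show "(LINT x|lborel. (\<Prod>b\<in>Basis. f b (x \<bullet> b))) = (\<Prod>b\<in>Basis. integral\<^sup>L lborel (f b))" .
qed

text \<open>Up to the factor \<open>sqrt (2 * pi)\<close> the integrand is the standard normal
  density times a character, so the value is read off the characteristic function of the normal
  distribution.\<close>

lemma
  fixes t :: real
  shows integrable_gaussian_cis_real: "integrable lborel (\<lambda>x. complex_of_real (exp (- x\<^sup>2 / 2)) * cis (t * x))"
    and fourier_gaussian_real:
      "(LINT x|lborel. complex_of_real (exp (- x\<^sup>2 / 2)) * cis (t * x)) = complex_of_real (sqrt (2 * pi) * exp (- t\<^sup>2 / 2))"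
proof -
  have dens: "complex_of_real (exp (- x\<^sup>2 / 2)) * cis (t * x) =
     complex_of_real (sqrt (2 * pi)) * (std_normal_density x *\<^sub>R iexp (t * x))" for x
    by (simp add: normal_density_def cis_conv_exp scaleR_conv_of_real flip: of_real_mult)
  have int: "integrable lborel (\<lambda>x. std_normal_density x *\<^sub>R iexp (t * x))"
    by (rule Bochner_Integration.integrable_bound[OF integrable_normal_density[of 1 0]])
       (auto simp: norm_mult)
  then show "integrable lborel (\<lambda>x. complex_of_real (exp (- x\<^sup>2 / 2)) * cis (t * x))"
    unfolding dens by (rule integrable_mult_right)
  have "(LINT x|lborel. std_normal_density x *\<^sub>R iexp (t * x)) = char std_normal_distribution t"
    unfolding char_def by (subst integral_density) (auto simp: normal_density_nonneg)
  then show "(LINT x|lborel. complex_of_real (exp (- x\<^sup>2 / 2)) * cis (t * x)) = complex_of_real (sqrt (2 * pi) * exp (- t\<^sup>2 / 2))"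
    unfolding dens integral_mult_right_zero by (simp add: char_std_normal_distribution)
qed

text \<open>With this normalisation the transform with kernel \<open>cis (t \<bullet> x)\<close>
  reproduces \<open>gauss\<close> up to a constant; the factor 2 pi in \<open>fourier\<close> enters
  later by scaling.\<close>

definition gauss :: "'a::euclidean_space \<Rightarrow> real" where
  "gauss x = exp (- (norm x)\<^sup>2 / 2)"

lemma gauss_pos: "gauss x > 0" and gauss_le_1: "gauss x \<le> 1"
  by (auto simp: gauss_def)

lemma borel_measurable_gauss [measurable]: "gauss \<in> borel_measurable borel"
  unfolding gauss_def by measurable

text \<open>Both the Gaussian and the character factor over the coordinates, so the one-dimensional
  formula is multiplied over \<open>Basis\<close>.\<close>

lemma
  fixes t :: "'a::euclidean_space"
  shows integrable_gauss_cis: "integrable lborel (\<lambda>x. complex_of_real (gauss x) * cis (t \<bullet> x))"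
    and fourier_gauss:
      "(LINT x|lborel. complex_of_real (gauss x) * cis (t \<bullet> x)) = complex_of_real ((sqrt (2 * pi)) ^ DIM('a) * gauss t)"
proof -
  have gprod: "gauss x = (\<Prod>b\<in>Basis. exp (- (x \<bullet> b)\<^sup>2 / 2))" for x :: 'a
    unfolding gauss_def
    by (subst power2_norm_eq_inner, subst euclidean_inner)
       (simp add: sum_divide_distrib flip: exp_sum sum_negf power2_eq_square)
  have cprod: "cis (t \<bullet> x) = (\<Prod>b\<in>Basis. cis ((t \<bullet> b) * (x \<bullet> b)))" for x :: 'a
    by (subst euclidean_inner) (simp add: cis_conv_exp exp_sum sum_distrib_left)
  have eq: "complex_of_real (gauss x) * cis (t \<bullet> x)
     = (\<Prod>b\<in>Basis. complex_of_real (exp (- (x \<bullet> b)\<^sup>2 / 2)) * cis ((t \<bullet> b) * (x \<bullet> b)))" for x :: 'a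
    unfolding cprod gprod by (simp add: prod.distrib)
  show "integrable lborel (\<lambda>x. complex_of_real (gauss x) * cis (t \<bullet> x))"
    unfolding eq by (rule integrable_lborel_prod) (rule integrable_gaussian_cis_real)
  show "(LINT x|lborel. complex_of_real (gauss x) * cis (t \<bullet> x)) = complex_of_real ((sqrt (2 * pi)) ^ DIM('a) * gauss t)"
    unfolding eq integral_lborel_prod[OF integrable_gaussian_cis_real] fourier_gaussian_real
    by (simp add: gprod prod.distrib)
qed

lemma
  shows integrable_gauss: "integrable lborel (gauss :: 'a::euclidean_space \<Rightarrow> real)"
    and integral_gauss: "(LINT x|lborel. gauss (x::'a)) = (sqrt (2 * pi)) ^ DIM('a)"
proof -
  have "integrable lborel (\<lambda>x::'a. complex_of_real (gauss x))"
    using integrable_gauss_cis[of "0::'a"] by simp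
  then show "integrable lborel (gauss :: 'a \<Rightarrow> real)" by (simp only: complex_of_real_integrable_eq)
  have "complex_of_real (LINT x|lborel. gauss (x::'a)) = complex_of_real ((sqrt (2 * pi)) ^ DIM('a))"
    using fourier_gauss[of "0::'a"] by (simp add: gauss_def)
  then show "(LINT x|lborel. gauss (x::'a)) = (sqrt (2 * pi)) ^ DIM('a)" by (simp only: of_real_eq_iff)
qed

section \<open>Fubini with a bounded kernel, and boxes as test sets\<close>

lemma integral_lborel_affine:
  fixes f :: "'a::euclidean_space \<Rightarrow> 'b::{banach, second_countable_topology}"
  assumes [measurable]: "f \<in> borel_measurable borel" and c: "c \<noteq> 0"
  shows "(LINT x|lborel. f x) = \<bar>c\<bar> ^ DIM('a) *\<^sub>R (LINT x|lborel. f (t + c *\<^sub>R x))"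
  by (subst lborel_affine[OF c, of t]) (simp add: integral_density integral_distr)

text \<open>The integrable function \<open>C * norm (u x) * norm (v y)\<close> on the product
  dominates the double integrand. All exchanges of Bochner integrals in the inversion and Plancherel
  arguments are instances of this.\<close>

lemma Fubini_bounded_kernel:
  fixes u :: "'a::euclidean_space \<Rightarrow> complex" and v :: "'b::euclidean_space \<Rightarrow> complex"
  assumes u: "integrable lborel u" and v: "integrable lborel v"
    and m[measurable]: "(\<lambda>(x, y). m x y) \<in> borel_measurable (borel \<Otimes>\<^sub>M borel)"
    and le: "\<And>x y. norm (m x y) \<le> C"
  shows "(LINT x|lborel. u x * (LINT y|lborel. m x y * v y)) = (LINT y|lborel. v y * (LINT x|lborel. m x y * u x))"
proof -
  have [measurable]: "u \<in> borel_measurable borel" "v \<in> borel_measurable borel"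
    using borel_measurable_integrable[OF u] borel_measurable_integrable[OF v] by auto
  have "integrable (lborel \<Otimes>\<^sub>M lborel) (\<lambda>(x, y). norm (u x) * norm (v y))"
    using u v by (intro lborel_pair.Fubini_integrable) (auto simp: norm_mult)
  then have "integrable (lborel \<Otimes>\<^sub>M lborel) (\<lambda>z. C * (case z of (x, y) \<Rightarrow> norm (u x) * norm (v y)))"
    by (rule integrable_mult_right)
  then have int: "integrable (lborel \<Otimes>\<^sub>M lborel) (\<lambda>(x, y). u x * (m x y * v y))"
  proof (rule Bochner_Integration.integrable_bound)
    have "norm (u x * (m x y * v y)) \<le> norm (C * (norm (u x) * norm (v y)))" for x y
    proof -
      have "norm (m x y) * (norm (u x) * norm (v y)) \<le> C * (norm (u x) * norm (v y))"
        by (intro mult_right_mono le) auto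
      then show ?thesis by (simp add: norm_mult mult_ac abs_mult) (smt (verit) le norm_ge_zero mult.commute)
    qed
    then show "AE z in lborel \<Otimes>\<^sub>M lborel. norm (case z of (x, y) \<Rightarrow> u x * (m x y * v y))
       \<le> norm (C * (case z of (x, y) \<Rightarrow> norm (u x) * norm (v y)))"
      by (intro AE_I2) (auto split: prod.split)
  qed measurable
  have "(LINT x|lborel. u x * (LINT y|lborel. m x y * v y)) = (LINT x|lborel. LINT y|lborel. u x * (m x y * v y))"
    by (simp add: integral_mult_right_zero)
  also have "\<dots> = (LINT y|lborel. LINT x|lborel. u x * (m x y * v y))"
    using lborel_pair.Fubini_integral[OF int] by simp
  also have "\<dots> = (LINT y|lborel. LINT x|lborel. v y * (m x y * u x))"
    by (simp add: mult_ac)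
  finally show ?thesis by (simp only: integral_mult_right_zero)
qed

text \<open>Boxes are an intersection-stable generator of the Borel sets, so a Dynkin-type induction
  extends the vanishing from boxes to all Borel sets, and a function whose integrals all vanish is
  zero almost everywhere.\<close>

lemma AE_zero_if_box_integrals_zero:
  fixes h :: "'a::euclidean_space \<Rightarrow> 'b::{banach, second_countable_topology}"
  assumes int: "\<And>a b. set_integrable lborel (box a b) h"
    and zero: "\<And>a b. set_lebesgue_integral lborel (box a b) h = 0"
  shows "AE x in lborel. h x = 0"
proof -
  \<comment> \<open>As \<open>h\<close> is only locally integrable, it is cut off to growing boxes.
    Each \<open>k n\<close> is integrable on the whole space, which the complement step of the
    induction requires.\<close>
  define Q where "Q n = box (- (real n *\<^sub>R One)) (real n *\<^sub>R One :: 'a)" for n :: nat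
  define k where "k n x = indicat_real (Q n) x *\<^sub>R h x" for n x
  have k: "integrable lborel (k n)" for n
    using int unfolding set_integrable_def k_def Q_def by simp
  have kint: "set_integrable lborel A (k n)" if "A \<in> sets borel" for A n
    using that k by (auto intro!: integrable_mult_indicator simp: set_integrable_def)
  have "set_lebesgue_integral lborel A (k n) = 0" if "A \<in> sets borel" for A n
  proof -
    have box: "set_lebesgue_integral lborel (box a b) (k n) = 0" for a b
    proof -
      obtain c d where cd: "box a b \<inter> Q n = box c d"
        unfolding Q_def box_Int_box by blast
      have "indicat_real (box a b) x *\<^sub>R k n x = indicat_real (box c d) x *\<^sub>R h x" for x
        unfolding k_def cd[symmetric] by (simp add: indicator_inter_arith)
      then show ?thesis using zero[of c d] by (simp add: set_lebesgue_integral_def)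
    qed
    have whole: "set_lebesgue_integral lborel UNIV (k n) = 0"
      using zero unfolding k_def Q_def set_lebesgue_integral_def by simp
    have sets: "sigma_sets UNIV (range (\<lambda>(a, b). box a b :: 'a set)) = sets borel"
      by (simp add: borel_eq_box)
    have stable: "Int_stable (range (\<lambda>(a, b). box a b :: 'a set))"
      by (auto simp: Int_stable_def box_Int_box image_iff)
    have A: "A \<in> sigma_sets UNIV (range (\<lambda>(a, b). box a b :: 'a set))"
      using that sets by simp
    have "range (\<lambda>(a, b). box a b :: 'a set) \<subseteq> Pow UNIV" by simp
    from stable this A show ?thesis
    proof (induction rule: sigma_sets_induct_disjoint)
      case (basic A)
      then show ?case using box by auto
    next
      case empty
      then show ?case by (simp add: set_lebesgue_integral_def)
    next
      case (compl A)
      then have [measurable]: "A \<in> sets borel" using sets by simp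
      have "set_lebesgue_integral lborel (A \<union> (UNIV - A)) (k n)
          = set_lebesgue_integral lborel A (k n) + set_lebesgue_integral lborel (UNIV - A) (k n)"
        by (rule set_integral_Un) (auto intro!: kint)
      then show ?case using compl whole by simp
    next
      case (union A)
      then have [measurable]: "A i \<in> sets borel" for i using sets by auto
      have "set_lebesgue_integral lborel (\<Union>i. A i) (k n) = (\<Sum>i. set_lebesgue_integral lborel (A i) (k n))"
        using union by (intro lebesgue_integral_countable_add kint) (auto simp: disjoint_family_on_def)
      then show ?case using union by simp
    qed
  qed
  then have "AE x in lborel. k n x = 0" for n
    by (intro sigma_finite_measure.density_zero[OF sigma_finite_lborel] k) auto
  then have "AE x in lborel. \<forall>n. k n x = 0" by (simp add: AE_all_countable)
  then show ?thesis
  proof eventually_elim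
    case (elim x)
    obtain n where "x \<in> Q n"
      using UN_box_eq_UNIV by (auto simp: Q_def)
    with elim[rule_format, of n] show ?case by (simp add: k_def)
  qed
qed


text \<open>The indicator is locally constant off the boundary, which is a null set. The quantifier
  over \<open>X\<close> stands inside \<open>AE\<close>, so one exceptional set serves all sequences
  at once, even uncountably many.\<close>

lemma AE_tendsto_indicator_box:
  fixes a b :: "'a::euclidean_space"
  shows "AE x in lborel. \<forall>X. X \<longlonglongrightarrow> x \<longrightarrow> (\<lambda>n. indicat_real (box a b) (X n)) \<longlonglongrightarrow> indicator (box a b) x"
proof -
  have "cbox a b - box a b \<in> null_sets lborel"
    using negligible_frontier_interval[of a b]
    by (subst null_sets_completion_iff[symmetric]) (auto simp: negligible_iff_null_sets)
  then have "AE x in lborel. x \<notin> cbox a b - box a b" by (rule AE_not_in)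
  then show ?thesis
  proof (eventually_elim, intro allI impI)
    fix x and X :: "nat \<Rightarrow> 'a" assume x: "x \<notin> cbox a b - box a b" and X: "X \<longlonglongrightarrow> x"
    have "\<forall>\<^sub>F n in sequentially. indicat_real (box a b) (X n) = indicator (box a b) x"
    proof (cases "x \<in> box a b")
      case True
      from topological_tendstoD[OF X open_box True] show ?thesis
        by eventually_elim (use True in simp)
    next
      case False
      then have "x \<in> - cbox a b" using x by auto
      from topological_tendstoD[OF X _ this] have "\<forall>\<^sub>F n in sequentially. X n \<in> - cbox a b"
        by (simp add: closed_cbox open_Compl)
      then show ?thesis
        by eventually_elim (use False box_subset_cbox[of a b] in \<open>auto simp: indicator_def\<close>)
    qed
    then show "(\<lambda>n. indicat_real (box a b) (X n)) \<longlonglongrightarrow> indicator (box a b) x"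
      by (rule tendsto_eventually)
  qed
qed

section \<open>Gaussian regularisation, inversion and Plancherel\<close>

lemma borel_measurable_cnj [measurable]: "cnj \<in> borel_measurable borel"
  by (intro borel_measurable_continuous_onI continuous_intros)

lemma borel_measurable_cis [measurable]: "cis \<in> borel_measurable borel"
  by (intro borel_measurable_continuous_onI continuous_intros)

text \<open>Substituting \<open>w / e\<close> for \<open>w\<close> reduces this to
  \<open>fourier_gauss\<close>. As a function of \<open>v\<close> the result is a Gaussian of width
  \<open>e / (2 * pi)\<close> and total mass 1, that is, an approximate identity as \<open>e\<close>
  tends to 0.\<close>

lemma fourier_gauss_scaled:
  fixes v :: "'a::euclidean_space"
  assumes e: "e > 0"
  shows "(LINT w|lborel. cis (2 * pi * (w \<bullet> v)) * complex_of_real (gauss (e *\<^sub>R w)))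
    = complex_of_real ((sqrt (2 * pi) / e) ^ DIM('a) * gauss ((2 * pi / e) *\<^sub>R v))"
proof -
  have "(LINT w|lborel. cis (2 * pi * (w \<bullet> v)) * complex_of_real (gauss (e *\<^sub>R w)))
     = \<bar>1 / e\<bar> ^ DIM('a) *\<^sub>R (LINT w|lborel. cis (2 * pi * ((0 + (1 / e) *\<^sub>R w) \<bullet> v)) * complex_of_real (gauss (e *\<^sub>R (0 + (1 / e) *\<^sub>R w))))"
    by (rule integral_lborel_affine) (use e in auto)
  also have "(LINT w|lborel. cis (2 * pi * ((0 + (1 / e) *\<^sub>R w) \<bullet> v)) * complex_of_real (gauss (e *\<^sub>R (0 + (1 / e) *\<^sub>R w))))
     = (LINT w|lborel. complex_of_real (gauss w) * cis (((2 * pi / e) *\<^sub>R v) \<bullet> w))"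
    using e by (intro Bochner_Integration.integral_cong refl) (simp add: inner_commute mult_ac)
  also have "\<dots> = complex_of_real ((sqrt (2 * pi)) ^ DIM('a) * gauss ((2 * pi / e) *\<^sub>R v))"
    by (rule fourier_gauss)
  finally show ?thesis
    using e by (simp add: scaleR_conv_of_real power_divide)
qed

lemma integrable_gauss_scaled:
  assumes e: "e > 0"
  shows "integrable lborel (\<lambda>w::'a::euclidean_space. complex_of_real (gauss (e *\<^sub>R w)))"
proof -
  have "integrable lborel (\<lambda>w::'a. gauss (e *\<^sub>R w))"
  proof (subst lborel_affine[of "1 / e" 0])
    show "integrable (density (distr lborel borel (\<lambda>x. 0 + (1 / e) *\<^sub>R x)) (\<lambda>_. \<bar>1 / e\<bar> ^ DIM('a))) (\<lambda>w::'a. gauss (e *\<^sub>R w))"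
      using e integrable_gauss by (subst integrable_density) (auto simp: integrable_distr_eq)
  qed (use e in auto)
  then show ?thesis by simp
qed

text \<open>
  The given function is only Lebesgue measurable; \<open>g\<close> stands for a Borel representative of it.
\<close>

context
  fixes g F :: "'a::euclidean_space \<Rightarrow> complex"
  assumes g: "integrable lborel g" and F: "integrable lborel F"
    and F_eq: "\<And>w. F w = (LINT x|lborel. cis (- (2 * pi * (x \<bullet> w))) * g x)"
begin

private lemma g_borel [measurable]: "g \<in> borel_measurable borel"
  using borel_measurable_integrable[OF g] by simp

private lemma F_borel [measurable]: "F \<in> borel_measurable borel"
  using borel_measurable_integrable[OF F] by simp

definition "invF y = (LINT w|lborel. cis (2 * pi * (w \<bullet> y)) * F w)"

private lemma invF_borel [measurable]: "invF \<in> borel_measurable borel"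
  unfolding invF_def by measurable

lemma norm_invF_le: "norm (invF y) \<le> (LINT w|lborel. norm (F w))"
  unfolding invF_def
  by (rule order.trans[OF integral_norm_bound]) (simp add: norm_mult)

text \<open>The Gaussian factor makes the double integral over \<open>w\<close> and \<open>x\<close>
  absolutely convergent. One exchange turns the regularised inverse transform into a convolution of
  \<open>g\<close>; a second moves the smoothing from \<open>g\<close> onto the indicator of the
  box.\<close>

lemma regularised_inversion_box:
  assumes e: "e > 0"
  shows "(LINT y|lborel. indicator (box a b) y * (LINT w|lborel. cis (2 * pi * (w \<bullet> y)) * (complex_of_real (gauss (e *\<^sub>R w)) * F w)))
    = (LINT x|lborel. g x * complex_of_real ((LINT z|lborel. gauss z * indicator (box a b) (x + (e / (2 * pi)) *\<^sub>R z)) / sqrt (2 * pi) ^ DIM('a)))"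
proof -
  have integrable_indicator_box: "integrable lborel (indicator (box a b) :: 'a \<Rightarrow> complex)"
    using integrable_real_indicator[OF _ emeasure_lborel_box_finite[of a b]]
    by (simp flip: complex_of_real_integrable_eq add: of_real_indicator)
  \<comment> \<open>The closed form of the transformed Gaussian from
    \<open>fourier_gauss_scaled\<close>, used as convolution kernel.\<close>
  define k :: "'a \<Rightarrow> complex" where "k v = complex_of_real ((sqrt (2 * pi) / e) ^ DIM('a) * gauss ((2 * pi / e) *\<^sub>R v))" for v
  have [measurable]: "k \<in> borel_measurable borel" unfolding k_def by measurable
  have kle: "norm (k v) \<le> (sqrt (2 * pi) / e) ^ DIM('a)" for v
    using e gauss_pos[of "(2 * pi / e) *\<^sub>R v"] gauss_le_1[of "(2 * pi / e) *\<^sub>R v"]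
    by (simp add: k_def norm_mult norm_power norm_divide mult_left_le)
  have inner: "(LINT w|lborel. cis (2 * pi * (w \<bullet> y)) * (complex_of_real (gauss (e *\<^sub>R w)) * F w))
     = (LINT x|lborel. k (y - x) * g x)" for y
  proof -
    have "(LINT w|lborel. cis (2 * pi * (w \<bullet> y)) * (complex_of_real (gauss (e *\<^sub>R w)) * F w))
      = (LINT w|lborel. complex_of_real (gauss (e *\<^sub>R w)) * (LINT x|lborel. cis (2 * pi * (w \<bullet> (y - x))) * g x))"
    proof (intro Bochner_Integration.integral_cong refl)
      fix w
      have "cis (2 * pi * (w \<bullet> y)) * F w = (LINT x|lborel. cis (2 * pi * (w \<bullet> y)) * (cis (- (2 * pi * (x \<bullet> w))) * g x))"
        unfolding F_eq by simp
      also have "\<dots> = (LINT x|lborel. cis (2 * pi * (w \<bullet> (y - x))) * g x)"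
      proof (intro Bochner_Integration.integral_cong refl)
        fix x
        have "2 * pi * (w \<bullet> y) + - (2 * pi * (x \<bullet> w)) = 2 * pi * (w \<bullet> (y - x))"
          by (simp add: inner_diff_right inner_commute[of x w] algebra_simps)
        then show "cis (2 * pi * (w \<bullet> y)) * (cis (- (2 * pi * (x \<bullet> w))) * g x) = cis (2 * pi * (w \<bullet> (y - x))) * g x"
          by (simp only: mult.assoc[symmetric] cis_mult)
      qed
      finally show "cis (2 * pi * (w \<bullet> y)) * (complex_of_real (gauss (e *\<^sub>R w)) * F w)
        = complex_of_real (gauss (e *\<^sub>R w)) * (LINT x|lborel. cis (2 * pi * (w \<bullet> (y - x))) * g x)"
        by (simp add: mult_ac)
    qed
    also have "\<dots> = (LINT x|lborel. g x * (LINT w|lborel. cis (2 * pi * (w \<bullet> (y - x))) * complex_of_real (gauss (e *\<^sub>R w))))"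
      by (rule Fubini_bounded_kernel[where C=1]) (auto intro!: integrable_gauss_scaled e g)
    finally show ?thesis unfolding fourier_gauss_scaled[OF e] k_def by (simp only: mult.commute)
  qed
  have "(LINT y|lborel. indicator (box a b) y * (LINT w|lborel. cis (2 * pi * (w \<bullet> y)) * (complex_of_real (gauss (e *\<^sub>R w)) * F w)))
     = (LINT x|lborel. g x * (LINT y|lborel. k (y - x) * indicator (box a b) y))"
    unfolding inner
    by (rule Fubini_bounded_kernel[where C="(sqrt (2 * pi) / e) ^ DIM('a)"])
       (use integrable_indicator_box in \<open>auto intro!: g kle\<close>)
  moreover have "(LINT y|lborel. k (y - x) * indicator (box a b) y)
     = complex_of_real ((LINT z|lborel. gauss z * indicator (box a b) (x + (e / (2 * pi)) *\<^sub>R z)) / sqrt (2 * pi) ^ DIM('a))" for x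
  proof -
    have "(LINT y|lborel. k (y - x) * indicator (box a b) y)
      = complex_of_real (LINT y|lborel. (sqrt (2 * pi) / e) ^ DIM('a) * (gauss ((2 * pi / e) *\<^sub>R (y - x)) * indicator (box a b) y))"
      unfolding integral_complex_of_real[symmetric]
      by (intro Bochner_Integration.integral_cong refl) (simp add: k_def indicator_def)
    also have "(LINT y|lborel. (sqrt (2 * pi) / e) ^ DIM('a) * (gauss ((2 * pi / e) *\<^sub>R (y - x)) * indicator (box a b) y))
      = (sqrt (2 * pi) / e) ^ DIM('a) * (LINT y|lborel. (gauss ((2 * pi / e) *\<^sub>R (y - x)) * indicator (box a b) y))"
      by simp
    \<comment> \<open>The substitution \<open>y = x + (e / (2 * pi)) *\<^sub>R z\<close> undoes the
      scaling of the kernel and leaves a fixed Gaussian average over shifts that shrink with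
      \<open>e\<close>.\<close>
    also have "(LINT y|lborel. (gauss ((2 * pi / e) *\<^sub>R (y - x)) * indicator (box a b) y))
      = \<bar>e / (2 * pi)\<bar> ^ DIM('a) *\<^sub>R (LINT z|lborel. (gauss ((2 * pi / e) *\<^sub>R ((x + (e / (2 * pi)) *\<^sub>R z) - x)) * indicator (box a b) (x + (e / (2 * pi)) *\<^sub>R z)))"
      by (rule integral_lborel_affine) (use e in auto)
    also have "(sqrt (2 * pi) / e) ^ DIM('a) * (\<bar>e / (2 * pi)\<bar> ^ DIM('a) *\<^sub>R (LINT z|lborel. (gauss ((2 * pi / e) *\<^sub>R ((x + (e / (2 * pi)) *\<^sub>R z) - x)) * indicator (box a b) (x + (e / (2 * pi)) *\<^sub>R z))))
      = ((sqrt (2 * pi) / e) * (e / (2 * pi))) ^ DIM('a) * (LINT z|lborel. gauss z * indicator (box a b) (x + (e / (2 * pi)) *\<^sub>R z))"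
      unfolding power_mult_distrib using e by simp
    also have "(sqrt (2 * pi) / e) * (e / (2 * pi)) = 1 / sqrt (2 * pi)"
      using e by (simp add: field_simps)
    finally show ?thesis by (simp add: power_divide)
  qed
  ultimately show ?thesis by simp
qed

text \<open>
  The Gaussian factor is the transform of an approximate identity; boxes serve as test functions since
  their boundary is a null set, and they determine a locally integrable function.
\<close>
lemma inversion_box:
  "(LINT y|lborel. indicator (box a b) y * invF y) = (LINT x|lborel. g x * indicator (box a b) x)"
proof (rule LIMSEQ_unique)
  define e where "e n = 1 / real (Suc n)" for n
  have e: "e n > 0" for n by (simp add: e_def)
  have e0: "e \<longlonglongrightarrow> 0" unfolding e_def by (rule lim_1_over_real_power[of 1, simplified, THEN LIMSEQ_Suc])
  \<comment> \<open>Both sides of the claim are limits of \<open>?L\<close>: one by letting the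
    Gaussian factor tend to 1 inside the integral, the other after rewriting with
    \<open>regularised_inversion_box\<close>.\<close>
  let ?L = "\<lambda>n. (LINT y|lborel. indicator (box a b) y * (LINT w|lborel. cis (2 * pi * (w \<bullet> y)) * (complex_of_real (gauss (e n *\<^sub>R w)) * F w)))"
  have gl: "(\<lambda>n. gauss (e n *\<^sub>R w)) \<longlonglongrightarrow> 1" for w :: 'a
  proof -
    have "(\<lambda>n. exp (- (norm (e n *\<^sub>R w))\<^sup>2 / 2)) \<longlonglongrightarrow> exp (- (norm (0 *\<^sub>R w))\<^sup>2 / 2)"
      by (intro tendsto_intros e0) auto
    then show ?thesis by (simp add: gauss_def)
  qed
  have nle: "norm (complex_of_real (gauss w)) \<le> 1" for w :: 'a
    using gauss_pos[of w] gauss_le_1[of w] by simp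
  have in1: "norm (cis (2 * pi * (w \<bullet> y)) * (complex_of_real (gauss (e n *\<^sub>R w)) * F w)) \<le> norm (F w)" for n w y
    using mult_right_mono[OF nle[of "e n *\<^sub>R w"], of "norm (F w)"] by (simp add: norm_mult)
  show "?L \<longlonglongrightarrow> (LINT y|lborel. indicator (box a b) y * invF y)"
  proof (rule integral_dominated_convergence[where w="\<lambda>y. indicator (box a b) y * (LINT w|lborel. norm (F w))"])
    show "integrable lborel (\<lambda>y. indicat_real (box a b) y * (LINT w|lborel. norm (F w)))"
      by (intro integrable_mult_left integrable_real_indicator emeasure_lborel_box_finite) auto
    show "AE y in lborel. (\<lambda>n. indicator (box a b) y * (LINT w|lborel. cis (2 * pi * (w \<bullet> y)) * (complex_of_real (gauss (e n *\<^sub>R w)) * F w))) \<longlonglongrightarrow> indicator (box a b) y * invF y"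
    proof (intro AE_I2 tendsto_intros)
      fix y
      show "(\<lambda>n. (LINT w|lborel. cis (2 * pi * (w \<bullet> y)) * (complex_of_real (gauss (e n *\<^sub>R w)) * F w))) \<longlonglongrightarrow> invF y"
        unfolding invF_def
      proof (rule integral_dominated_convergence[where w="\<lambda>w. norm (F w)"])
        have "(\<lambda>n. cis (2 * pi * (w \<bullet> y)) * (complex_of_real (gauss (e n *\<^sub>R w)) * F w)) \<longlonglongrightarrow> cis (2 * pi * (w \<bullet> y)) * (complex_of_real 1 * F w)" for w
          by (intro tendsto_intros gl)
        then show "AE w in lborel. (\<lambda>n. cis (2 * pi * (w \<bullet> y)) * (complex_of_real (gauss (e n *\<^sub>R w)) * F w)) \<longlonglongrightarrow> cis (2 * pi * (w \<bullet> y)) * F w"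
          by simp
      qed (use F in1 in auto)
    qed
    fix n
    show "AE y in lborel. norm (indicator (box a b) y * (LINT w|lborel. cis (2 * pi * (w \<bullet> y)) * (complex_of_real (gauss (e n *\<^sub>R w)) * F w))) \<le> indicator (box a b) y * (LINT w|lborel. norm (F w))"
    proof (intro AE_I2)
      fix y
      have "norm (LINT w|lborel. cis (2 * pi * (w \<bullet> y)) * (complex_of_real (gauss (e n *\<^sub>R w)) * F w)) \<le> (LINT w|lborel. norm (F w))"
        by (rule Bochner_Integration.integral_norm_bound_integral)
           (use F in1 in \<open>auto intro!: Bochner_Integration.integrable_bound[OF F]\<close>)
      then show "norm (indicator (box a b) y * (LINT w|lborel. cis (2 * pi * (w \<bullet> y)) * (complex_of_real (gauss (e n *\<^sub>R w)) * F w))) \<le> indicator (box a b) y * (LINT w|lborel. norm (F w))"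
        by (auto simp: norm_mult indicator_def)
    qed
  qed auto
  \<comment> \<open>\<open>?J n x\<close> is the mean of the indicator near \<open>x\<close> under a
    Gaussian probability measure. It lies between 0 and 1, so \<open>norm (g x)\<close> is a
    dominating function.\<close>
  let ?J = "\<lambda>n x. (LINT z|lborel. gauss z * indicator (box a b) (x + (e n / (2 * pi)) *\<^sub>R z)) / sqrt (2 * pi) ^ DIM('a)"
  have J01: "0 \<le> ?J n x" "?J n x \<le> 1" for n x
  proof -
    show "0 \<le> ?J n x"
      by (intro divide_nonneg_pos integral_nonneg) (auto simp: gauss_pos less_imp_le)
    have "(LINT z|lborel. gauss z * indicator (box a b) (x + (e n / (2 * pi)) *\<^sub>R z)) \<le> (LINT z|lborel. gauss (z::'a))"
    proof (rule integral_mono_AE')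
      show "AE z in lborel. gauss z * indicator (box a b) (x + (e n / (2 * pi)) *\<^sub>R z) \<le> gauss (z::'a)"
        by (auto simp: indicator_def gauss_pos less_imp_le)
    qed (auto simp: integrable_gauss gauss_pos less_imp_le)
    then show "?J n x \<le> 1" by (simp add: integral_gauss)
  qed
  have "(\<lambda>n. LINT x|lborel. g x * complex_of_real (?J n x)) \<longlonglongrightarrow> (LINT x|lborel. g x * indicator (box a b) x)"
  proof (rule integral_dominated_convergence[where w="\<lambda>x. norm (g x)"])
    show "AE x in lborel. (\<lambda>n. g x * complex_of_real (?J n x)) \<longlonglongrightarrow> g x * indicator (box a b) x"
      using AE_tendsto_indicator_box[of a b]
    proof eventually_elim
      case (elim x)
      \<comment> \<open>For a fixed good point \<open>x\<close>, each \<open>z\<close> gives its own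
        sequence converging to \<open>x\<close>; the quantifier over sequences in
        \<open>elim\<close> covers all of them.\<close>
      have "(\<lambda>n. (LINT z|lborel. gauss z * indicator (box a b) (x + (e n / (2 * pi)) *\<^sub>R z))) \<longlonglongrightarrow> (LINT z|lborel. gauss (z::'a) * indicator (box a b) x)"
      proof (rule integral_dominated_convergence[where w=gauss])
        show "AE z in lborel. (\<lambda>n. gauss z * indicator (box a b) (x + (e n / (2 * pi)) *\<^sub>R z)) \<longlonglongrightarrow> gauss (z::'a) * indicator (box a b) x"
        proof (intro AE_I2 tendsto_intros elim[rule_format])
          fix z
          have "(\<lambda>n. x + (e n / (2 * pi)) *\<^sub>R z) \<longlonglongrightarrow> x + (0 / (2 * pi)) *\<^sub>R z"
            by (intro tendsto_intros e0) auto
          then show "(\<lambda>n. x + (e n / (2 * pi)) *\<^sub>R z) \<longlonglongrightarrow> x" by simp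
        qed
      qed (auto simp: integrable_gauss indicator_def gauss_pos less_imp_le)
      then have "(\<lambda>n. ?J n x) \<longlonglongrightarrow> (LINT z|lborel. gauss (z::'a) * indicator (box a b) x) / sqrt (2 * pi) ^ DIM('a)"
        by (intro tendsto_intros) auto
      also have "(LINT z|lborel. gauss (z::'a) * indicator (box a b) x) / sqrt (2 * pi) ^ DIM('a) = indicator (box a b) x"
        by (simp add: integral_gauss)
      finally have "(\<lambda>n. g x * complex_of_real (?J n x)) \<longlonglongrightarrow> g x * complex_of_real (indicator (box a b) x)"
        by (intro tendsto_intros)
      then show ?case by (simp add: of_real_indicator)
    qed
    show "AE x in lborel. norm (g x * complex_of_real (?J n x)) \<le> norm (g x)" for n
    proof (intro AE_I2)
      fix x
      have "norm (complex_of_real (?J n x)) \<le> 1"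
        using J01[of x n] by (simp only: norm_of_real abs_of_nonneg)
      then show "norm (g x * complex_of_real (?J n x)) \<le> norm (g x)"
        unfolding norm_mult by (rule mult_left_le) simp
    qed
  qed (use g in auto)
  then show "?L \<longlonglongrightarrow> (LINT x|lborel. g x * indicator (box a b) x)"
    unfolding regularised_inversion_box[OF e] .
qed

text \<open>\<open>invF\<close> is bounded by the L1 norm of \<open>F\<close>, hence integrable on
  boxes, and by \<open>inversion_box\<close> the difference \<open>g - invF\<close> has integral
  zero over every box.\<close>

lemma fourier_inversion_AE: "AE x in lborel. g x = invF x"
proof -
  have invF: "integrable lborel (\<lambda>x. indicat_real (box a b) x *\<^sub>R invF x)" for a b
  proof (rule Bochner_Integration.integrable_bound)
    show "integrable lborel (\<lambda>y. indicat_real (box a b) y * (LINT w|lborel. norm (F w)))"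
      by (intro integrable_mult_left integrable_real_indicator emeasure_lborel_box_finite) auto
    show "AE x in lborel. norm (indicat_real (box a b) x *\<^sub>R invF x) \<le> norm (indicat_real (box a b) x * (LINT w|lborel. norm (F w)))"
      using norm_invF_le by (auto simp: indicator_def intro!: AE_I2 order.trans[OF _ abs_ge_self])
  qed measurable
  have gi: "integrable lborel (\<lambda>x. indicat_real (box a b) x *\<^sub>R g x)" for a b
    by (rule integrable_mult_indicator) (use g in auto)
  have "AE x in lborel. g x - invF x = 0"
  proof (rule AE_zero_if_box_integrals_zero)
    fix a b :: 'a
    show "set_integrable lborel (box a b) (\<lambda>x. g x - invF x)"
      unfolding set_integrable_def scaleR_diff_right by (intro Bochner_Integration.integrable_diff invF gi)
    have "set_lebesgue_integral lborel (box a b) (\<lambda>x. g x - invF x)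
       = (LINT x|lborel. indicat_real (box a b) x *\<^sub>R g x) - (LINT x|lborel. indicat_real (box a b) x *\<^sub>R invF x)"
      unfolding set_lebesgue_integral_def scaleR_diff_right by (intro Bochner_Integration.integral_diff invF gi)
    also have "\<dots> = 0"
      using inversion_box[of a b] by (simp add: scaleR_conv_of_real of_real_indicator mult_ac)
    finally show "set_lebesgue_integral lborel (box a b) (\<lambda>x. g x - invF x) = 0" .
  qed
  then show ?thesis by eventually_elim simp
qed

lemma norm_le_L1_transform_AE: "AE x in lborel. norm (g x) \<le> (LINT w|lborel. norm (F w))"
  using fourier_inversion_AE by eventually_elim (simp add: norm_invF_le)

lemma norm_transform_le_L1: "norm (F w) \<le> (LINT x|lborel. norm (g x))"
  unfolding F_eq by (rule order.trans[OF integral_norm_bound]) (simp add: norm_mult)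

text \<open>In \<open>g * cnj g\<close> the conjugated factor is replaced by its inversion integral;
  exchanging the integrals makes the transform of \<open>g\<close> reappear.\<close>

lemma plancherel_lborel: "(LINT x|lborel. (norm (g x))\<^sup>2) = (LINT w|lborel. (norm (F w))\<^sup>2)"
proof -
  have "complex_of_real (LINT x|lborel. (norm (g x))\<^sup>2) = (LINT x|lborel. g x * cnj (g x))"
    unfolding integral_complex_of_real[symmetric] by (simp add: complex_norm_square del: of_real_power flip: of_real_power)
  also have "\<dots> = (LINT x|lborel. g x * cnj (invF x))"
  proof (rule integral_cong_AE)
    show "AE x in lborel. g x * cnj (g x) = g x * cnj (invF x)"
      using fourier_inversion_AE by eventually_elim simp
  qed measurable
  also have "\<dots> = (LINT x|lborel. g x * (LINT w|lborel. cis (- (2 * pi * (x \<bullet> w))) * cnj (F w)))"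
    unfolding invF_def Bochner_Integration.integral_cnj[symmetric] complex_cnj_mult cis_cnj by (simp add: inner_commute)
  also have "\<dots> = (LINT w|lborel. cnj (F w) * (LINT x|lborel. cis (- (2 * pi * (x \<bullet> w))) * g x))"
    by (rule Fubini_bounded_kernel[where C=1]) (use g F in auto)
  also have "\<dots> = (LINT w|lborel. F w * cnj (F w))"
    unfolding F_eq[symmetric] by (simp only: mult.commute)
  also have "\<dots> = complex_of_real (LINT w|lborel. (norm (F w))\<^sup>2)"
    unfolding integral_complex_of_real[symmetric] by (simp add: complex_norm_square del: of_real_power flip: of_real_power)
  finally show ?thesis by (simp only: of_real_eq_iff)
qed

end

section \<open>Bounding the \<open>L\<^sup>1\<close> norm by weighted norms\<close>

text \<open>Euler's integral after the substitution \<open>k * t\<close>. It serves to represent a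
  negative power of \<open>k\<close> as a mixture of exponentials.\<close>

lemma nn_integral_Gamma_scaled:
  assumes s: "s > 0" and k: "k > (0::real)"
  shows "(\<integral>\<^sup>+t. ennreal (indicator {0..} t * t powr (s - 1) * exp (- (k * t))) \<partial>lborel) = ennreal (Gamma s * k powr (- s))"
proof -
  let ?h = "\<lambda>t::real. ennreal (indicator {0..} t * t powr (s - 1) / exp t)"
  have "ennreal (Gamma s) = ennreal \<bar>k\<bar> * (\<integral>\<^sup>+t. ?h (0 + k * t) \<partial>lborel)"
    unfolding Gamma_conv_nn_integral_real[OF s] by (rule nn_integral_real_affine) (use k in auto)
  also have "(\<integral>\<^sup>+t. ?h (0 + k * t) \<partial>lborel)
     = (\<integral>\<^sup>+t. ennreal (k powr (s - 1)) * ennreal (indicator {0..} t * t powr (s - 1) * exp (- (k * t))) \<partial>lborel)"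
  proof (intro nn_integral_cong)
    fix t :: real
    show "?h (0 + k * t) = ennreal (k powr (s - 1)) * ennreal (indicator {0..} t * t powr (s - 1) * exp (- (k * t)))"
      using k by (auto simp: indicator_def powr_mult exp_minus field_simps zero_le_mult_iff simp flip: ennreal_mult)
  qed
  also have "\<dots> = ennreal (k powr (s - 1)) * (\<integral>\<^sup>+t. ennreal (indicator {0..} t * t powr (s - 1) * exp (- (k * t))) \<partial>lborel)"
    by (rule nn_integral_cmult) auto
  finally have "ennreal (Gamma s) = ennreal (k powr s) * (\<integral>\<^sup>+t. ennreal (indicator {0..} t * t powr (s - 1) * exp (- (k * t))) \<partial>lborel)"
    using k by (simp add: mult.assoc[symmetric] powr_diff flip: ennreal_mult)
  then have "ennreal (k powr (- s)) * ennreal (Gamma s) = ennreal (k powr (- s)) * ennreal (k powr s) * (\<integral>\<^sup>+t. ennreal (indicator {0..} t * t powr (s - 1) * exp (- (k * t))) \<partial>lborel)"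
    by (simp add: mult.assoc)
  also have "ennreal (k powr (- s)) * ennreal (k powr s) = 1"
    using k by (simp add: powr_minus flip: ennreal_mult)
  finally show ?thesis
    using s by (simp add: mult.commute Gamma_real_pos less_imp_le flip: ennreal_mult)
qed

text \<open>The power of \<open>1 + u\<close>, multiplied by \<open>Gamma (a + b)\<close>, is
  written as an integral over exponentials in \<open>t\<close>. After exchanging the integrals,
  integrating out \<open>u\<close> gives \<open>Gamma a\<close> and then integrating out
  \<open>t\<close> gives \<open>Gamma b\<close>.\<close>

lemma nn_integral_Beta_halfline:
  assumes a: "a > 0" and b: "b > (0::real)"
  shows "(\<integral>\<^sup>+u. ennreal (indicator {0..} u * u powr (a - 1) * (1 + u) powr (- (a + b))) \<partial>lborel) = ennreal (Beta a b)"
    (is "?I = _")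
proof -
  let ?g = "\<lambda>u t::real. ennreal (indicator {0..} u * u powr (a - 1) * (indicator {0..} t * t powr (a + b - 1) * exp (- ((1 + u) * t))))"
  have "ennreal (Gamma (a + b)) * ?I
     = (\<integral>\<^sup>+u. ennreal (Gamma (a + b)) * ennreal (indicator {0..} u * u powr (a - 1) * (1 + u) powr (- (a + b))) \<partial>lborel)"
    by (rule nn_integral_cmult[symmetric]) auto
  also have "\<dots> = (\<integral>\<^sup>+u. \<integral>\<^sup>+t. ?g u t \<partial>lborel \<partial>lborel)"
  proof (intro nn_integral_cong)
    fix u :: real
    have "(\<integral>\<^sup>+t. ?g u t \<partial>lborel) = (\<integral>\<^sup>+t. ennreal (indicator {0..} u * u powr (a - 1)) * ennreal (indicator {0..} t * t powr (a + b - 1) * exp (- ((1 + u) * t))) \<partial>lborel)"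
      by (intro nn_integral_cong) (auto simp: indicator_def simp flip: ennreal_mult)
    also have "\<dots> = ennreal (indicator {0..} u * u powr (a - 1)) * (\<integral>\<^sup>+t. ennreal (indicator {0..} t * t powr (a + b - 1) * exp (- ((1 + u) * t))) \<partial>lborel)"
      by (rule nn_integral_cmult) auto
    also have "\<dots> = ennreal (Gamma (a + b)) * ennreal (indicator {0..} u * u powr (a - 1) * (1 + u) powr (- (a + b)))"
    proof (cases "u \<ge> 0")
      case True
      then show ?thesis
        using a b nn_integral_Gamma_scaled[of "a + b" "1 + u"]
        by (simp add: Gamma_real_pos less_imp_le mult_ac flip: ennreal_mult)
    qed simp
    finally show "ennreal (Gamma (a + b)) * ennreal (indicator {0..} u * u powr (a - 1) * (1 + u) powr (- (a + b))) = (\<integral>\<^sup>+t. ?g u t \<partial>lborel)" ..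
  qed
  also have "\<dots> = (\<integral>\<^sup>+t. \<integral>\<^sup>+u. ?g u t \<partial>lborel \<partial>lborel)"
    by (rule lborel_pair.Fubini') measurable
  also have "\<dots> = (\<integral>\<^sup>+t. ennreal (Gamma a) * ennreal (indicator {0..} t * t powr (b - 1) * exp (- (1 * t))) \<partial>lborel)"
  proof (rule nn_integral_cong_AE)
    \<comment> \<open>The inner integral is a Gamma integral with rate \<open>t\<close>, which must
      be positive.\<close>
    have "AE t in lborel. t \<noteq> (0::real)" by (rule AE_lborel_singleton)
    then show "AE t in lborel. (\<integral>\<^sup>+u. ?g u t \<partial>lborel) = ennreal (Gamma a) * ennreal (indicator {0..} t * t powr (b - 1) * exp (- (1 * t)))"
    proof eventually_elim
      fix t :: real assume t0: "t \<noteq> 0"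
      have "(\<integral>\<^sup>+u. ?g u t \<partial>lborel) = (\<integral>\<^sup>+u. ennreal (indicator {0..} t * t powr (a + b - 1) * exp (- t)) * ennreal (indicator {0..} u * u powr (a - 1) * exp (- (t * u))) \<partial>lborel)"
        by (intro nn_integral_cong) (auto simp: indicator_def algebra_simps exp_diff exp_minus exp_add divide_simps simp flip: ennreal_mult)
      also have "\<dots> = ennreal (indicator {0..} t * t powr (a + b - 1) * exp (- t)) * (\<integral>\<^sup>+u. ennreal (indicator {0..} u * u powr (a - 1) * exp (- (t * u))) \<partial>lborel)"
        by (rule nn_integral_cmult) auto
      also have "\<dots> = ennreal (Gamma a) * ennreal (indicator {0..} t * t powr (b - 1) * exp (- (1 * t)))"
      proof (cases "t > 0")
        case True
        have "t powr (a + b - 1) * t powr (- a) = t powr (b - 1)"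
          by (simp flip: powr_add)
        then show ?thesis
          using a nn_integral_Gamma_scaled[OF a True] True
          by (simp add: Gamma_real_pos less_imp_le mult_ac flip: ennreal_mult)
      qed (use t0 in simp)
      finally show "(\<integral>\<^sup>+u. ?g u t \<partial>lborel) = ennreal (Gamma a) * ennreal (indicator {0..} t * t powr (b - 1) * exp (- (1 * t)))" .
    qed
  qed
  also have "\<dots> = ennreal (Gamma a) * (\<integral>\<^sup>+t. ennreal (indicator {0..} t * t powr (b - 1) * exp (- (1 * t))) \<partial>lborel)"
    by (rule nn_integral_cmult) auto
  also have "\<dots> = ennreal (Gamma a * Gamma b)"
    unfolding nn_integral_Gamma_scaled[OF b zero_less_one]
    using a b by (simp add: Gamma_real_pos less_imp_le flip: ennreal_mult)
  finally have *: "ennreal (Gamma (a + b)) * ?I = ennreal (Gamma a * Gamma b)" .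
  \<comment> \<open>Cancellation in \<open>ennreal\<close> is done by multiplying with the
    reciprocal of a positive finite constant.\<close>
  have "ennreal (1 / Gamma (a + b)) * ennreal (Gamma (a + b)) = 1"
    using Gamma_real_pos[OF add_pos_pos[OF a b]] by (simp flip: ennreal_mult)
  then have "?I = ennreal (1 / Gamma (a + b)) * (ennreal (Gamma (a + b)) * ?I)"
    by (simp flip: mult.assoc)
  also have "\<dots> = ennreal (Beta a b)"
    unfolding * using a b by (simp add: Gamma_real_pos less_imp_le Beta_def flip: ennreal_mult)
  finally show ?thesis .
qed

section \<open>Radial integrals without polar coordinates\<close>

text \<open>Sublevel sets of the weight are balls, so its distribution function is a constant times
  \<open>r powr a\<close>, and the density is the derivative of that. Half-lines
  \<open>{..r}\<close> generate the Borel sets, so comparing both measures on them suffices.\<close>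

lemma distr_lborel_norm_powr:
  fixes x0 :: "'a::euclidean_space"
  assumes p: "p > 0" and l: "l > 0"
  defines "a \<equiv> real DIM('a) / p"
  shows "distr lborel borel (\<lambda>x. l * norm (x - x0) powr p)
    = density lborel (\<lambda>u. ennreal (indicator {0..} u * (unit_ball_vol DIM('a) * l powr (- a) * a * u powr (a - 1))))"
    (is "?M = ?N")
proof (rule measure_eqI_generator_eq)
  have a: "a > 0" using p by (simp add: a_def)
  let ?c = "unit_ball_vol DIM('a) * l powr (- a)"
  show "Int_stable (range atMost :: real set set)"
    by (auto simp: Int_stable_def intro: min.cobounded1)
  show "range atMost \<subseteq> Pow (UNIV :: real set)" by simp
  show "sets ?M = sigma_sets UNIV (range atMost)" "sets ?N = sigma_sets UNIV (range atMost)"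
    by (simp_all add: borel_eq_atMost)
  have M: "emeasure ?M {..r} = ennreal (if r \<ge> 0 then ?c * r powr a else 0)" for r
  proof (cases "r \<ge> 0")
    case False
    have "0 \<le> l * norm (x - x0) powr p" for x using l by simp
    then have "r < l * norm (x - x0) powr p" for x using False by (meson not_le less_le_trans)
    then have "(\<lambda>x. l * norm (x - x0) powr p) -` {..r} = {}"
      using leD by blast
    then show ?thesis using False by (simp add: emeasure_distr)
  next
    case True
    \<comment> \<open>The radius at which \<open>l * norm (x - x0) powr p\<close> reaches
      \<open>r\<close>.\<close>
    let ?R = "(r / l) powr (1 / p)"
    have "l * norm (x - x0) powr p \<le> r \<longleftrightarrow> x \<in> cball x0 ?R" for x
    proof -
      have "l * norm (x - x0) powr p \<le> r \<longleftrightarrow> norm (x - x0) powr p \<le> ?R powr p"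
        using l p True by (simp add: powr_powr field_simps)
      also have "\<dots> \<longleftrightarrow> norm (x - x0) \<le> ?R"
        using p by (meson norm_ge_zero not_le powr_ge_zero powr_less_mono2 powr_mono2 less_imp_le)
      finally show ?thesis by (simp add: dist_norm norm_minus_commute)
    qed
    then have "(\<lambda>x. l * norm (x - x0) powr p) -` {..r} = cball x0 ?R"
      by auto
    then have "emeasure ?M {..r} = emeasure lborel (cball x0 ?R)"
      by (simp add: emeasure_distr)
    also have "\<dots> = ennreal (unit_ball_vol DIM('a) * ?R ^ DIM('a))"
      by (rule emeasure_cball) simp
    also have "?R ^ DIM('a) = l powr (- a) * r powr a"
    proof (cases "r = 0")
      case False
      then have "?R ^ DIM('a) = ?R powr real DIM('a)"
        using True l by (simp add: powr_realpow)
      also have "\<dots> = (r / l) powr a" by (simp add: powr_powr a_def)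
      finally show ?thesis using True l by (simp add: powr_divide powr_minus field_simps)
    qed simp
    finally show ?thesis using True by (simp add: mult.assoc)
  qed
  have N: "emeasure ?N {..r} = ennreal (if r \<ge> 0 then ?c * r powr a else 0)" for r
  proof (cases "r \<ge> 0")
    case False
    then have "indicat_real {0..} x * indicat_real {..r} x = 0" for x
      by (auto simp: indicator_def)
    then show ?thesis using False
      by (auto simp: emeasure_density nn_integral_0_iff_AE indicator_def)
  next
    case True
    have "emeasure ?N {..r} = (\<integral>\<^sup>+u. ennreal (indicator {0..r} u * (?c * a * u powr (a - 1))) \<partial>lborel)"
      using a by (subst emeasure_density) (auto intro!: nn_integral_cong simp: indicator_def)
    also have "\<dots> = ennreal (?c * r powr a)"
    proof (rule nn_integral_has_integral_lebesgue)
      show "0 \<le> ?c * a * u powr (a - 1)" if "u \<in> {0..r}" for u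
        using a by simp
      have "((\<lambda>u. ?c * a * u powr (a - 1)) has_integral ?c * a * (r powr (a - 1 + 1) / (a - 1 + 1))) {0..r}"
        by (intro has_integral_mult_right has_integral_powr_from_0) (use a True in auto)
      then show "((\<lambda>u. ?c * a * u powr (a - 1)) has_integral ?c * r powr a) {0..r}"
        using a by (simp add: mult.assoc)
    qed
    finally show ?thesis using True by simp
  qed
  show "emeasure ?M X = emeasure ?N X" if "X \<in> range atMost" for X
    using that M N by auto
  show "range (\<lambda>n. {..real n}) \<subseteq> range atMost" by auto
  show "(\<Union>n. {..real n}) = UNIV" using real_arch_simple by auto
  show "emeasure ?M {..real i} \<noteq> \<infinity>" for i unfolding M by simp
qed

text \<open>Integration of a radial function against the image measure just computed; it plays the
  role of polar coordinates.\<close>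

lemma nn_integral_lborel_norm_powr:
  fixes x0 :: "'a::euclidean_space"
  assumes p: "p > 0" and l: "l > 0" and [measurable]: "h \<in> borel_measurable borel"
  defines "a \<equiv> real DIM('a) / p"
  shows "(\<integral>\<^sup>+x. ennreal (h (l * norm (x - x0) powr p)) \<partial>lborel)
    = ennreal (unit_ball_vol DIM('a) * l powr (- a) * a) * (\<integral>\<^sup>+u. ennreal (indicator {0..} u * u powr (a - 1) * h u) \<partial>lborel)"
proof -
  have a: "a > 0" using p by (simp add: a_def)
  have "(\<integral>\<^sup>+x. ennreal (h (l * norm (x - x0) powr p)) \<partial>lborel)
     = (\<integral>\<^sup>+u. ennreal (h u) \<partial>distr lborel borel (\<lambda>x. l * norm (x - x0) powr p))"
    by (simp add: nn_integral_distr)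
  also have "\<dots> = (\<integral>\<^sup>+u. ennreal (unit_ball_vol DIM('a) * l powr (- a) * a) * ennreal (indicator {0..} u * u powr (a - 1) * h u) \<partial>lborel)"
    unfolding distr_lborel_norm_powr[OF p l] a_def[symmetric]
  proof (subst nn_integral_density)
    have "ennreal (indicator {0..} u * (unit_ball_vol DIM('a) * l powr (- a) * a * u powr (a - 1))) * ennreal (h u)
       = ennreal (unit_ball_vol DIM('a) * l powr (- a) * a) * ennreal (indicator {0..} u * u powr (a - 1) * h u)" for u
      using a by (subst (1 2) ennreal_mult'[symmetric]) (simp_all add: mult_ac)
    then show "(\<integral>\<^sup>+u. ennreal (indicator {0..} u * (unit_ball_vol DIM('a) * l powr (- a) * a * u powr (a - 1))) * ennreal (h u) \<partial>lborel)
       = (\<integral>\<^sup>+u. ennreal (unit_ball_vol DIM('a) * l powr (- a) * a) * ennreal (indicator {0..} u * u powr (a - 1) * h u) \<partial>lborel)"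
      by simp
  qed measurable
  finally show ?thesis by (subst (asm) nn_integral_cmult) auto
qed


text \<open>The Beta integral on the half-line with parameters \<open>a\<close> and
  \<open>c - a\<close>; the assumption on \<open>c\<close> is convergence at infinity.\<close>

lemma nn_integral_weight_powr:
  fixes x0 :: "'a::euclidean_space"
  assumes p: "p > 0" and l: "l > 0" and c: "real DIM('a) / p < c"
  defines "a \<equiv> real DIM('a) / p"
  shows "(\<integral>\<^sup>+x. ennreal ((1 + l * norm (x - x0) powr p) powr (- c)) \<partial>lborel)
    = ennreal (unit_ball_vol DIM('a) * l powr (- a) * a * Beta a (c - a))"
proof -
  have a: "a > 0" using p by (simp add: a_def)
  have ca: "c - a > 0" using c by (simp add: a_def)
  have B: "Beta a (c - a) > 0"
    using a ca by (simp add: Beta_def Gamma_real_pos)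
  have "(\<integral>\<^sup>+x. ennreal ((1 + l * norm (x - x0) powr p) powr (- c)) \<partial>lborel)
     = ennreal (unit_ball_vol DIM('a) * l powr (- a) * a) * (\<integral>\<^sup>+u. ennreal (indicator {0..} u * u powr (a - 1) * (1 + u) powr (- c)) \<partial>lborel)"
    using nn_integral_lborel_norm_powr[OF p l, of "\<lambda>u. (1 + u) powr (- c)" x0] unfolding a_def by simp
  also have "(\<integral>\<^sup>+u. ennreal (indicator {0..} u * u powr (a - 1) * (1 + u) powr (- c)) \<partial>lborel) = ennreal (Beta a (c - a))"
    using nn_integral_Beta_halfline[OF a ca] by simp
  finally show ?thesis using a B by (simp flip: ennreal_mult)
qed

section \<open>The weighted inequality for finite exponents\<close>

text \<open>Hoelder's inequality for the factorisation of \<open>F\<close> into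
  \<open>F * v powr (1 / q)\<close> and \<open>v powr (- 1 / q)\<close>, proved by integrating
  Young's inequality pointwise.\<close>

lemma nn_integral_le_Holder_weight:
  fixes F v :: "'a \<Rightarrow> real"
  assumes q: "q > 1" and P: "P > 0" and Q: "Q > 0"
    and [measurable]: "F \<in> borel_measurable M" "v \<in> borel_measurable M"
    and F: "\<And>x. F x \<ge> 0" and v: "\<And>x. v x > 0"
    and intP: "(\<integral>\<^sup>+x. ennreal (F x powr q * v x) \<partial>M) \<le> ennreal P"
    and intQ: "(\<integral>\<^sup>+x. ennreal (v x powr (- (1 / (q - 1)))) \<partial>M) \<le> ennreal Q"
  shows "(\<integral>\<^sup>+x. ennreal (F x) \<partial>M) \<le> ennreal (P powr (1 / q) * Q powr ((q - 1) / q))"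
proof -
  define r where "r = q / (q - 1)"
  define C where "C = P powr (1 / q) * Q powr ((q - 1) / q)"
  have r: "r > 1" using q by (simp add: r_def)
  have qr: "1 / q + 1 / r = 1" using q by (simp add: r_def field_simps)
  have C: "C > 0" using P Q by (simp add: C_def)
  have pt: "F x \<le> C * (F x powr q * v x / (q * P) + v x powr (- (1 / (q - 1))) / (r * Q))" for x
  proof -
    \<comment> \<open>The two factors are normalised so that \<open>?A powr q\<close> and
      \<open>?B powr r\<close> have integral at most 1; the conjugate weights \<open>1 / q\<close>
      and \<open>1 / r\<close> then add up to 1.\<close>
    let ?A = "F x * v x powr (1 / q) / P powr (1 / q)" and ?B = "v x powr (- 1 / q) / Q powr ((q - 1) / q)"
    have "?A * ?B \<le> ?A powr q / q + ?B powr r / r"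
      by (rule Youngs_inequality) (use q r qr F in auto)
    moreover have "?A powr q = F x powr q * v x / P"
      using F[of x] v[of x] P q by (simp add: powr_mult powr_divide powr_powr)
    moreover have "?B powr r = v x powr (- (1 / (q - 1))) / Q"
      using v[of x] Q q by (simp add: powr_divide powr_powr r_def)
    moreover have "?A * ?B = F x / C"
      using v[of x] by (simp add: C_def powr_minus powr_divide field_simps)
    ultimately have "F x / C \<le> F x powr q * v x / P / q + v x powr (- (1 / (q - 1))) / Q / r" by simp
    then show ?thesis using C by (simp add: field_simps)
  qed
  have "(\<integral>\<^sup>+x. ennreal (F x) \<partial>M) \<le> (\<integral>\<^sup>+x. ennreal (C / (q * P)) * ennreal (F x powr q * v x) + ennreal (C / (r * Q)) * ennreal (v x powr (- (1 / (q - 1)))) \<partial>M)"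
  proof (intro nn_integral_mono)
    fix x
    have "ennreal (C / (q * P)) * ennreal (F x powr q * v x) + ennreal (C / (r * Q)) * ennreal (v x powr (- (1 / (q - 1))))
       = ennreal (C / (q * P) * (F x powr q * v x) + C / (r * Q) * v x powr (- (1 / (q - 1))))"
      using C q P r Q v[of x] by (subst (1 2) ennreal_mult[symmetric]) (auto simp flip: ennreal_plus)
    then show "ennreal (F x) \<le> ennreal (C / (q * P)) * ennreal (F x powr q * v x) + ennreal (C / (r * Q)) * ennreal (v x powr (- (1 / (q - 1))))"
      using pt[of x] by (simp add: ennreal_leI algebra_simps)
  qed
  also have "\<dots> = ennreal (C / (q * P)) * (\<integral>\<^sup>+x. ennreal (F x powr q * v x) \<partial>M) + ennreal (C / (r * Q)) * (\<integral>\<^sup>+x. ennreal (v x powr (- (1 / (q - 1)))) \<partial>M)"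
    by (simp add: nn_integral_add nn_integral_cmult)
  also have "\<dots> \<le> ennreal (C / (q * P)) * ennreal P + ennreal (C / (r * Q)) * ennreal Q"
    by (intro add_mono mult_left_mono intP intQ) auto
  also have "\<dots> = ennreal (C / q + C / r)"
    using C q r P Q by (simp flip: ennreal_mult ennreal_plus)
  also have "C / q + C / r = C" using arg_cong[OF qr, of "\<lambda>z. C * z"] by (simp add: algebra_simps)
  finally show ?thesis unfolding C_def .
qed

text \<open>
  The weight parameter \<open>\<theta> n / ((1 - \<theta>) w)\<close> minimises \<open>l powr (- \<theta>) * (n + l * w)\<close> over \<open>l > 0\<close>.
\<close>
lemma optimal_weight_constant:
  fixes n w X \<theta> q a c :: real
  assumes pos: "n > 0" "w > 0" "X > 0" "0 < \<theta>" "\<theta> < 1" "q > 0" and ac: "a * c = \<theta> / q"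
  shows "(n / (1 - \<theta>)) powr (1 / q) * (X * (\<theta> * n / ((1 - \<theta>) * w)) powr (- a)) powr c
    = X powr c * (1 / \<theta> - 1) powr (\<theta> / q) * (1 - \<theta>) powr (- 1 / q)
      * (n powr (1 / q)) powr (1 - \<theta>) * (w powr (1 / q)) powr \<theta>" (is "?l = ?r")
proof -
  have th: "1 / \<theta> - 1 = (1 - \<theta>) / \<theta>" using pos by (simp add: field_simps)
  \<comment> \<open>Both sides are positive products of powers, so the identity becomes linear after
    taking logarithms; \<open>a * c\<close> is the only product of exponents to be replaced.\<close>
  have "ln ?l = (ln n - ln (1 - \<theta>)) / q + c * ln X - (a * c) * (ln \<theta> + ln n - ln (1 - \<theta>) - ln w)"
    using pos by (simp add: ln_mult ln_div ln_powr) (simp add: algebra_simps add_divide_distrib diff_divide_distrib)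
  also have "\<dots> = ln ?r"
    unfolding ac th using pos
    by (simp add: ln_mult ln_div ln_powr) (simp add: algebra_simps add_divide_distrib diff_divide_distrib)
  finally show ?thesis using pos th by (simp add: ln_inj_iff)
qed

text \<open>The right-hand side is the surface area of the unit sphere, the form in which the
  constant occurs in \<open>Ktilde\<close>.\<close>

lemma unit_ball_vol_Gamma:
  assumes "d > 0"
  shows "unit_ball_vol d * d = 2 * pi powr (d / 2) / Gamma (d / 2)"
proof -
  have "Gamma (d / 2 + 1) = d / 2 * Gamma (d / 2)"
    by (rule Gamma_plus1) (use assms in auto)
  then show ?thesis unfolding unit_ball_vol_def using assms by (simp only:) simp
qed

text \<open>With the weight \<open>v\<close>, the integral of \<open>norm (f x) powr q * v x\<close>
  splits into \<open>n + l * w\<close>, while the dual integral of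
  \<open>v powr (- (1 / (q - 1)))\<close> is a Beta value times \<open>l powr (- a)\<close>. The
  choice of \<open>l\<close> balances the two.\<close>

lemma L1_le_weighted_Lq:
  fixes f :: "'a::euclidean_space \<Rightarrow> complex" and x0 :: 'a
  assumes [measurable]: "f \<in> borel_measurable lebesgue"
    and q: "1 < q" and \<alpha>: "\<alpha> > real DIM('a) / conj_exp (ereal q)"
    and n: "(\<integral>\<^sup>+x. ennreal (norm (f x) powr q) \<partial>lebesgue) = ennreal n" "n > 0"
    and w: "(\<integral>\<^sup>+x. ennreal (norm (complex_of_real (norm (x - x0) powr \<alpha>) * f x) powr q) \<partial>lebesgue) = ennreal w" "w > 0"
  defines "\<theta> \<equiv> real DIM('a) / (\<alpha> * conj_exp (ereal q))"
  shows "(\<integral>\<^sup>+x. ennreal (norm (f x)) \<partial>lebesgue)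
    \<le> ennreal (Ktilde DIM('a) \<alpha> (ereal q) * (n powr (1 / q)) powr (1 - \<theta>) * (w powr (1 / q)) powr \<theta>)"
proof -
  define d where "d = real DIM('a)"
  have d: "d > 0" by (simp add: d_def)
  have ce: "conj_exp (ereal q) = q / (q - 1)" by (simp add: conj_exp_def)
  have q': "conj_exp (ereal q) > 0" using q by (simp add: ce)
  have \<alpha>0: "\<alpha> > 0" using \<alpha> q' d unfolding d_def[symmetric] by (meson divide_pos_pos less_trans)
  have \<theta>: "0 < \<theta>" "\<theta> < 1"
    using \<alpha> \<alpha>0 q' d by (auto simp: \<theta>_def field_simps d_def[symmetric])
  define p where "p = \<alpha> * q"
  define a where "a = d / p"
  define l where "l = \<theta> * n / ((1 - \<theta>) * w)"
  have p: "p > 0" using \<alpha>0 q by (simp add: p_def)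
  have a: "a > 0" using d p by (simp add: a_def)
  have l: "l > 0" using \<theta> n w by (simp add: l_def)
  have ac: "a * ((q - 1) / q) = \<theta> / q"
    using q \<alpha>0 by (simp add: a_def p_def \<theta>_def ce d_def)
  \<comment> \<open>Since \<open>a * (q - 1) = \<theta>\<close>, the condition \<theta> < 1 is
    exactly the convergence of the dual integral.\<close>
  have a_less: "a < 1 / (q - 1)"
  proof -
    have "a * (q - 1) = \<theta>" using ac q by (simp add: field_simps)
    then show ?thesis using \<theta> q by (simp add: field_simps)
  qed
  have B: "Beta a (1 / (q - 1) - a) > 0"
    using a a_less q by (simp add: Beta_def Gamma_real_pos)
  \<comment> \<open>The bracket in the definition of \<open>Ktilde\<close>, equal to the dual
    integral at \<open>l = 1\<close>.\<close>
  define X where "X = 2 * pi powr (d / 2) / Gamma (d / 2) * (1 / (\<alpha> * q)) * Beta a (1 / (q - 1) - a)"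
  have X: "X > 0" using d \<alpha>0 q B by (simp add: X_def Gamma_real_pos)
  define v where "v x = 1 + l * norm (x - x0) powr p" for x
  have v: "v x > 0" for x using l by (simp add: v_def add_pos_nonneg)
  have [measurable]: "v \<in> borel_measurable lebesgue"
    unfolding v_def by (rule measurable_completion) measurable
  have "(\<integral>\<^sup>+x. ennreal (norm (f x)) \<partial>lebesgue) \<le> ennreal ((n / (1 - \<theta>)) powr (1 / q) * (X * l powr (- a)) powr ((q - 1) / q))"
  proof (rule nn_integral_le_Holder_weight[where v=v])
    have "(\<integral>\<^sup>+x. ennreal (norm (f x) powr q * v x) \<partial>lebesgue)
      = (\<integral>\<^sup>+x. ennreal (norm (f x) powr q) + ennreal l * ennreal (norm (complex_of_real (norm (x - x0) powr \<alpha>) * f x) powr q) \<partial>lebesgue)"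
    proof (intro nn_integral_cong)
      fix x
      have "norm (f x) powr q * v x = norm (f x) powr q + l * norm (complex_of_real (norm (x - x0) powr \<alpha>) * f x) powr q"
        by (simp add: v_def norm_mult powr_mult powr_powr p_def algebra_simps)
      then show "ennreal (norm (f x) powr q * v x) = ennreal (norm (f x) powr q) + ennreal l * ennreal (norm (complex_of_real (norm (x - x0) powr \<alpha>) * f x) powr q)"
        using l by (simp add: ennreal_plus ennreal_mult less_imp_le)
    qed
    also have "\<dots> = ennreal n + ennreal l * ennreal w"
    proof -
      have [measurable]: "(\<lambda>x. complex_of_real (norm (x - x0) powr \<alpha>)) \<in> borel_measurable lebesgue"
        by (rule measurable_completion) measurable
      show ?thesis unfolding n(1)[symmetric] w(1)[symmetric]
        by (simp add: nn_integral_add nn_integral_cmult)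
    qed
    also have "\<dots> = ennreal (n + l * w)"
      using n w l by (simp add: ennreal_plus ennreal_mult less_imp_le)
    \<comment> \<open>The optimal \<open>l\<close> satisfies
      \<open>l * w = \<theta> * n / (1 - \<theta>)\<close>.\<close>
    also have "n + l * w = n / (1 - \<theta>)"
      using w \<theta> by (simp add: l_def field_simps)
    finally show "(\<integral>\<^sup>+x. ennreal (norm (f x) powr q * v x) \<partial>lebesgue) \<le> ennreal (n / (1 - \<theta>))" by simp
    have "(\<integral>\<^sup>+x. ennreal (v x powr (- (1 / (q - 1)))) \<partial>lebesgue) = ennreal (unit_ball_vol d * l powr (- a) * a * Beta a (1 / (q - 1) - a))"
      unfolding nn_integral_completion v_def a_def d_def
      by (rule nn_integral_weight_powr) (use p l a_less in \<open>auto simp: a_def d_def\<close>)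
    also have "unit_ball_vol d * l powr (- a) * a * Beta a (1 / (q - 1) - a) = X * l powr (- a)"
      unfolding X_def unit_ball_vol_Gamma[OF d, symmetric] by (simp add: a_def p_def)
    finally show "(\<integral>\<^sup>+x. ennreal (v x powr (- (1 / (q - 1)))) \<partial>lebesgue) \<le> ennreal (X * l powr (- a))" by simp
  qed (use q n \<theta> X l v in auto)
  also have "(n / (1 - \<theta>)) powr (1 / q) * (X * l powr (- a)) powr ((q - 1) / q)
     = X powr ((q - 1) / q) * (1 / \<theta> - 1) powr (\<theta> / q) * (1 - \<theta>) powr (- 1 / q) * (n powr (1 / q)) powr (1 - \<theta>) * (w powr (1 / q)) powr \<theta>"
    unfolding l_def by (rule optimal_weight_constant) (use n w X \<theta> q ac in auto)
  also have "X powr ((q - 1) / q) * (1 / \<theta> - 1) powr (\<theta> / q) * (1 - \<theta>) powr (- 1 / q) = Ktilde DIM('a) \<alpha> (ereal q)"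
  proof -
    have "\<theta> / q = d / (q * conj_exp (ereal q) * \<alpha>)" "1 / \<theta> = \<alpha> * conj_exp (ereal q) / d"
      by (simp_all add: \<theta>_def d_def mult_ac)
    moreover have "1 - \<theta> = 1 - d / (\<alpha> * conj_exp (ereal q))"
      by (simp add: \<theta>_def d_def)
    ultimately show ?thesis
      unfolding Ktilde_def Let_def X_def a_def p_def d_def[symmetric] by (simp add: mult_ac)
  qed
  finally show ?thesis .
qed

section \<open>The weighted inequality for the infinite exponent\<close>

text \<open>Almost everywhere \<open>norm (f x)\<close> is below both \<open>n\<close> and
  \<open>w / norm (x - x0) powr \<alpha>\<close>. Their minimum is a radial function, integrable at
  infinity because \<alpha> exceeds the dimension.\<close>

lemma L1_le_weighted_Linf:
  fixes f :: "'a::euclidean_space \<Rightarrow> complex" and x0 :: 'a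
  assumes \<alpha>: "\<alpha> > real DIM('a)"
    and n: "AE x in lebesgue. norm (f x) \<le> n" "n > 0"
    and w: "AE x in lebesgue. norm (complex_of_real (norm (x - x0) powr \<alpha>) * f x) \<le> w" "w > 0"
  defines "\<theta> \<equiv> real DIM('a) / \<alpha>"
  shows "(\<integral>\<^sup>+x. ennreal (norm (f x)) \<partial>lebesgue) \<le> ennreal (Ktilde DIM('a) \<alpha> \<infinity> * n powr (1 - \<theta>) * w powr \<theta>)"
proof -
  define d where "d = real DIM('a)"
  have d: "d > 0" by (simp add: d_def)
  have \<alpha>0: "\<alpha> > 0" using \<alpha> d by (simp add: d_def)
  have \<theta>: "0 < \<theta>" "\<theta> < 1" using \<alpha> \<alpha>0 d by (auto simp: \<theta>_def d_def)
  \<comment> \<open>With \<open>l = n / w\<close> the two bounds cross where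
    \<open>l * norm (x - x0) powr \<alpha>\<close> equals 1, so their minimum is \<open>n\<close>
    times \<open>h\<close> of this quantity.\<close>
  define l where "l = n / w"
  have l: "l > 0" using n w by (simp add: l_def)
  define h :: "real \<Rightarrow> real" where "h u = (if u \<le> 1 then 1 else 1 / u)" for u
  have [measurable]: "h \<in> borel_measurable borel" unfolding h_def by measurable
  have "(\<integral>\<^sup>+x. ennreal (norm (f x)) \<partial>lebesgue) \<le> (\<integral>\<^sup>+x. ennreal n * ennreal (h (l * norm (x - x0) powr \<alpha>)) \<partial>lebesgue)"
  proof (rule nn_integral_mono_AE)
    show "AE x in lebesgue. ennreal (norm (f x)) \<le> ennreal n * ennreal (h (l * norm (x - x0) powr \<alpha>))"
      using n(1) w(1)
    proof eventually_elim
      case (elim x)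
      have "norm (f x) \<le> n * h (l * norm (x - x0) powr \<alpha>)"
      proof (cases "l * norm (x - x0) powr \<alpha> \<le> 1")
        case False
        then have "norm (x - x0) powr \<alpha> > 0" using l by (cases "x = x0") auto
        then show ?thesis using False elim n w by (simp add: h_def l_def norm_mult field_simps)
      qed (use elim in \<open>simp add: h_def\<close>)
      then show ?case using n by (simp add: ennreal_mult'[symmetric] ennreal_leI)
    qed
  qed
  also have "\<dots> = ennreal n * (\<integral>\<^sup>+x. ennreal (h (l * norm (x - x0) powr \<alpha>)) \<partial>lborel)"
    unfolding nn_integral_completion by (rule nn_integral_cmult) measurable
  also have "(\<integral>\<^sup>+x. ennreal (h (l * norm (x - x0) powr \<alpha>)) \<partial>lborel)
     = ennreal (unit_ball_vol d * l powr (- \<theta>) * \<theta>) * (\<integral>\<^sup>+u. ennreal (indicator {0..} u * u powr (\<theta> - 1) * h u) \<partial>lborel)"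
    unfolding d_def \<theta>_def by (rule nn_integral_lborel_norm_powr) (use \<alpha>0 l in auto)
  also have "(\<integral>\<^sup>+u. ennreal (indicator {0..} u * u powr (\<theta> - 1) * h u) \<partial>lborel)
     = (\<integral>\<^sup>+u. ennreal (indicator {0..1} u * u powr (\<theta> - 1)) + ennreal (indicator {1..} u * u powr (\<theta> - 2)) \<partial>lborel)"
  proof (rule nn_integral_cong_AE)
    \<comment> \<open>At \<open>u = 1\<close> the two indicators on the right overlap.\<close>
    have "AE u in lborel. u \<noteq> (1::real)" by (rule AE_lborel_singleton)
    then show "AE u in lborel. ennreal (indicator {0..} u * u powr (\<theta> - 1) * h u) = ennreal (indicator {0..1} u * u powr (\<theta> - 1)) + ennreal (indicator {1..} u * u powr (\<theta> - 2))"
    proof eventually_elim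
      case (elim u)
      have "u powr (\<theta> - 1) / u = u powr (\<theta> - 2)" if "u > 1"
      proof -
        have "u powr (\<theta> - 1) / u = u powr (\<theta> - 1) / u powr 1" using that by simp
        also have "\<dots> = u powr (\<theta> - 1 - 1)" by (rule powr_diff[symmetric])
        finally show ?thesis by simp
      qed
      then show ?case using elim by (auto simp: indicator_def h_def)
    qed
  qed
  also have "\<dots> = (\<integral>\<^sup>+u. ennreal (indicator {0..1} u * u powr (\<theta> - 1)) \<partial>lborel) + (\<integral>\<^sup>+u. ennreal (indicator {1..} u * u powr (\<theta> - 2)) \<partial>lborel)"
    by (rule nn_integral_add) auto
  also have "(\<integral>\<^sup>+u. ennreal (indicator {0..1} u * u powr (\<theta> - 1)) \<partial>lborel) = ennreal (1 / \<theta>)"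
    using has_integral_powr_from_0[of "\<theta> - 1" 1] \<theta> by (intro nn_integral_has_integral_lebesgue) auto
  also have "(\<integral>\<^sup>+u. ennreal (indicator {1..} u * u powr (\<theta> - 2)) \<partial>lborel) = ennreal (1 / (1 - \<theta>))"
  proof (intro nn_integral_has_integral_lebesgue)
    have "((\<lambda>u. u powr (\<theta> - 2)) has_integral - (1 powr (\<theta> - 2 + 1)) / (\<theta> - 2 + 1)) {1..}"
      by (rule has_integral_powr_to_inf) (use \<theta> in auto)
    also have "- (1 powr (\<theta> - 2 + 1)) / (\<theta> - 2 + 1) = 1 / (1 - \<theta>)"
      using \<theta> by (simp add: field_simps)
    finally show "((\<lambda>u. u powr (\<theta> - 2)) has_integral 1 / (1 - \<theta>)) {1..}" .
  qed auto
  also have "ennreal n * (ennreal (unit_ball_vol d * l powr (- \<theta>) * \<theta>) * (ennreal (1 / \<theta>) + ennreal (1 / (1 - \<theta>))))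
     = ennreal (n * (unit_ball_vol d * l powr (- \<theta>) * \<theta> * (1 / \<theta> + 1 / (1 - \<theta>))))"
    using \<theta> n d by (simp add: ennreal_mult ennreal_plus less_imp_le)
  also have "n * (unit_ball_vol d * l powr (- \<theta>) * \<theta> * (1 / \<theta> + 1 / (1 - \<theta>))) = unit_ball_vol d / (1 - \<theta>) * (n * l powr (- \<theta>))"
    using \<theta> by (simp add: field_simps)
  also have "n * l powr (- \<theta>) = n powr (1 - \<theta>) * w powr \<theta>"
    using n w by (simp add: l_def powr_diff powr_minus powr_divide field_simps)
  also have "unit_ball_vol d / (1 - \<theta>) = Ktilde DIM('a) \<alpha> \<infinity>"
  proof -
    have "1 - \<theta> = (\<alpha> - d) / \<alpha>" using \<alpha>0 by (simp add: \<theta>_def d_def field_simps)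
    then have "unit_ball_vol d / (1 - \<theta>) = unit_ball_vol d * d * (\<alpha> / (d * (\<alpha> - d)))"
      using d \<alpha> \<alpha>0 by (simp add: d_def)
    then show ?thesis unfolding unit_ball_vol_Gamma[OF d] Ktilde_def by (simp add: d_def)
  qed
  finally show ?thesis by (simp add: mult.assoc)
qed

section \<open>The uncertainty principle\<close>

text \<open>Real and imaginary parts have Borel versions. Changing \<open>f\<close> on a null set
  leaves \<open>fourier f\<close> unchanged at every point, so \<open>fourier f\<close> is a
  parameter integral of a Borel function and hence itself Borel.\<close>

lemma fourier_lborel_representative:
  fixes f :: "'a::euclidean_space \<Rightarrow> complex"
  assumes f: "integrable lebesgue f" and F: "integrable lebesgue (fourier f)"
  obtains g where "integrable lborel g" "AE x in lborel. f x = g x" "integrable lborel (fourier f)"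
    "\<And>w. fourier f w = (LINT x|lborel. cis (- (2 * pi * (x \<bullet> w))) * g x)"
proof -
  have fm[measurable]: "f \<in> borel_measurable lebesgue" using f by auto
  obtain g1 where g1[measurable]: "g1 \<in> borel_measurable lborel" and g1_eq: "AE x in lborel. Re (f x) = g1 x"
    using completion_ex_borel_measurable_real[of "\<lambda>x. Re (f x)" lborel] by auto
  obtain g2 where g2[measurable]: "g2 \<in> borel_measurable lborel" and g2_eq: "AE x in lborel. Im (f x) = g2 x"
    using completion_ex_borel_measurable_real[of "\<lambda>x. Im (f x)" lborel] by auto
  define g where "g x = complex_of_real (g1 x) + \<i> * complex_of_real (g2 x)" for x
  have gb[measurable]: "g \<in> borel_measurable borel" using g1 g2 unfolding g_def by simp
  have gl[measurable]: "g \<in> borel_measurable lebesgue" by (rule measurable_completion) simp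
  have eq: "AE x in lborel. f x = g x"
    using g1_eq g2_eq by eventually_elim (simp add: g_def complex_eq_iff)
  then have eq': "AE x in lebesgue. f x = g x" by (rule AE_completion)
  have "integrable lebesgue g"
    using f eq' by (subst integrable_cong_AE[of _ _ f]) auto
  then have g: "integrable lborel g" by (subst (asm) integrable_completion) auto
  have F_eq: "fourier f w = (LINT x|lborel. cis (- (2 * pi * (x \<bullet> w))) * g x)" for w
  proof -
    have [measurable]: "(\<lambda>x. cis (- (2 * pi * (x \<bullet> w)))) \<in> borel_measurable lebesgue"
      by (rule measurable_completion) measurable
    have "fourier f w = (LINT x|lebesgue. cis (- (2 * pi * (x \<bullet> w))) * f x)"
      by (simp add: fourier_def cis_conv_exp mult_ac)
    also have "\<dots> = (LINT x|lebesgue. cis (- (2 * pi * (x \<bullet> w))) * g x)"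
      by (rule integral_cong_AE) (use eq' in auto)
    also have "\<dots> = (LINT x|lborel. cis (- (2 * pi * (x \<bullet> w))) * g x)"
      by (rule integral_completion) measurable
    finally show ?thesis .
  qed
  have "fourier f \<in> borel_measurable borel"
    unfolding F_eq[abs_def] by measurable
  then have "integrable lborel (fourier f)"
    using F by (subst (asm) integrable_completion) auto
  with g eq F_eq that show thesis by blast
qed

lemma
  fixes f :: "'a::euclidean_space \<Rightarrow> complex"
  assumes f: "integrable lebesgue f" and F: "integrable lebesgue (fourier f)"
  shows norm_le_L1_fourier_AE: "AE x in lebesgue. norm (f x) \<le> (LINT w|lebesgue. norm (fourier f w))"
    and norm_fourier_le_L1: "norm (fourier f w) \<le> (LINT x|lebesgue. norm (f x))"
    and fourier_plancherel:
      "(\<integral>\<^sup>+x. ennreal ((norm (f x))\<^sup>2) \<partial>lebesgue) = (\<integral>\<^sup>+w. ennreal ((norm (fourier f w))\<^sup>2) \<partial>lebesgue)"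
proof -
  from fourier_lborel_representative[OF f F] obtain g
    where g: "integrable lborel g" and eq: "AE x in lborel. f x = g x" and Fl: "integrable lborel (fourier f)"
      and F_eq: "\<And>w. fourier f w = (LINT x|lborel. cis (- (2 * pi * (x \<bullet> w))) * g x)"
    by blast
  have gm[measurable]: "g \<in> borel_measurable borel" and Fm[measurable]: "fourier f \<in> borel_measurable borel"
    using borel_measurable_integrable[OF g] borel_measurable_integrable[OF Fl] by auto
  have eq': "AE x in lebesgue. f x = g x" using eq by (rule AE_completion)
  have fm[measurable]: "f \<in> borel_measurable lebesgue" using f by auto
  have gl[measurable]: "g \<in> borel_measurable lebesgue" by (rule measurable_completion) simp
  have HF: "(LINT w|lebesgue. norm (fourier f w)) = (LINT w|lborel. norm (fourier f w))"
    by (rule integral_completion) measurable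
  have Hg: "(LINT x|lebesgue. norm (f x)) = (LINT x|lborel. norm (g x))"
  proof -
    have "(LINT x|lebesgue. norm (f x)) = (LINT x|lebesgue. norm (g x))"
      by (rule integral_cong_AE) (use eq' in auto)
    also have "\<dots> = (LINT x|lborel. norm (g x))"
      by (rule integral_completion) measurable
    finally show ?thesis .
  qed
  have gle: "AE x in lborel. norm (g x) \<le> (LINT w|lborel. norm (fourier f w))"
    by (rule norm_le_L1_transform_AE[OF g Fl F_eq])
  have "AE x in lborel. norm (f x) \<le> (LINT w|lborel. norm (fourier f w))"
    using gle eq by eventually_elim simp
  then show "AE x in lebesgue. norm (f x) \<le> (LINT w|lebesgue. norm (fourier f w))"
    unfolding HF by (rule AE_completion)
  have Fle: "norm (fourier f w) \<le> (LINT x|lborel. norm (g x))" for w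
    by (rule norm_transform_le_L1[OF g Fl F_eq])
  then show "norm (fourier f w) \<le> (LINT x|lebesgue. norm (f x))" unfolding Hg .
  \<comment> \<open>A bounded integrable function is square integrable. This is needed to turn the
    Bochner form of Plancherel, where a divergent integral would read as 0, into an identity of
    nonnegative integrals.\<close>
  have square: "integrable lborel (\<lambda>x. (norm (h x))\<^sup>2)"
    if h: "integrable lborel h" and le: "AE x in lborel. norm (h x) \<le> c" for h :: "'a \<Rightarrow> complex" and c
  proof (rule Bochner_Integration.integrable_bound[of _ "\<lambda>x. c * norm (h x)"])
    show "integrable lborel (\<lambda>x. c * norm (h x))" using h by simp
    show "(\<lambda>x. (norm (h x))\<^sup>2) \<in> borel_measurable lborel" using borel_measurable_integrable[OF h] by simp
    show "AE x in lborel. norm ((norm (h x))\<^sup>2) \<le> norm (c * norm (h x))"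
      using le
    proof eventually_elim
      case (elim x)
      then have "norm (h x) * norm (h x) \<le> c * norm (h x)" by (intro mult_right_mono) auto
      then show ?case by (simp add: power2_eq_square)
    qed
  qed
  have "(\<integral>\<^sup>+x. ennreal ((norm (f x))\<^sup>2) \<partial>lebesgue) = (\<integral>\<^sup>+x. ennreal ((norm (g x))\<^sup>2) \<partial>lborel)"
    unfolding nn_integral_completion by (rule nn_integral_cong_AE) (use eq in auto)
  also have "\<dots> = ennreal (LINT x|lborel. (norm (g x))\<^sup>2)"
    by (rule nn_integral_eq_integral[OF square[OF g gle]]) simp
  also have "\<dots> = ennreal (LINT w|lborel. (norm (fourier f w))\<^sup>2)"
    by (simp only: plancherel_lborel[OF g Fl F_eq])
  also have "\<dots> = (\<integral>\<^sup>+w. ennreal ((norm (fourier f w))\<^sup>2) \<partial>lborel)"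
    by (rule nn_integral_eq_integral[symmetric, OF square[OF Fl AE_I2[OF Fle]]]) simp
  finally show "(\<integral>\<^sup>+x. ennreal ((norm (f x))\<^sup>2) \<partial>lebesgue) = (\<integral>\<^sup>+w. ennreal ((norm (fourier f w))\<^sup>2) \<partial>lebesgue)"
    unfolding nn_integral_completion .
qed

section \<open>The inequality in terms of \<open>Lqnorm\<close>\<close>

text \<open>The infimum of essential bounds is the infimum of a countable subfamily, and countably
  many null sets can be discarded together.\<close>

lemma AE_norm_le_Lqnorm_infinity:
  "AE x in lebesgue. ennreal (norm (f x)) \<le> Lqnorm \<infinity> f"
proof -
  let ?S = "{C. AE x in lebesgue. ennreal (norm (f x)) \<le> C}"
  have "\<infinity> \<in> ?S" by simp
  then have "?S \<noteq> {}" by blast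
  then obtain c :: "nat \<Rightarrow> ennreal" where c: "range c \<subseteq> ?S" "Inf ?S = (INF i. c i)"
    using ennreal_Inf_countable_INF[of ?S] by blast
  then have "AE x in lebesgue. ennreal (norm (f x)) \<le> c i" for i by auto
  then have "AE x in lebesgue. \<forall>i. ennreal (norm (f x)) \<le> c i" by (simp add: AE_all_countable)
  then show ?thesis
  proof eventually_elim
    case (elim x)
    then show ?case by (simp add: Lqnorm_def c(2) INF_greatest)
  qed
qed

lemma L1_le_Lqnorm_weighted:
  fixes f :: "'a::euclidean_space \<Rightarrow> complex" and x0 :: 'a
  assumes f: "f \<in> borel_measurable lebesgue"
    and q: "1 < q" and \<alpha>: "\<alpha> > real DIM('a) / conj_exp q"
  defines "N \<equiv> Lqnorm q f" and "W \<equiv> Lqnorm q (\<lambda>x. complex_of_real (norm (x - x0) powr \<alpha>) * f x)"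
    and "\<theta> \<equiv> real DIM('a) / (\<alpha> * conj_exp q)"
  assumes fin: "N \<noteq> \<infinity>" "W \<noteq> \<infinity>" and pos: "enn2real N > 0" "enn2real W > 0"
  shows "(\<integral>\<^sup>+x. ennreal (norm (f x)) \<partial>lebesgue)
    \<le> ennreal (Ktilde DIM('a) \<alpha> q * enn2real N powr (1 - \<theta>) * enn2real W powr \<theta>)"
proof (cases q)
  case (real r)
  let ?w = "\<lambda>x. complex_of_real (norm (x - x0) powr \<alpha>) * f x"
  define I where "I = (\<integral>\<^sup>+x. ennreal (norm (f x) powr r) \<partial>lebesgue)"
  define J where "J = (\<integral>\<^sup>+x. ennreal (norm (?w x) powr r) \<partial>lebesgue)"
  have N: "N = (if I = \<infinity> then \<infinity> else ennreal (enn2real I powr (1 / r)))"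
    and W: "W = (if J = \<infinity> then \<infinity> else ennreal (enn2real J powr (1 / r)))"
    by (simp_all add: N_def W_def Lqnorm_def real I_def J_def Let_def)
  have IJ: "I \<noteq> \<infinity>" "J \<noteq> \<infinity>" using fin N W by auto
  have eN: "enn2real N = enn2real I powr (1 / r)" and eW: "enn2real W = enn2real J powr (1 / r)"
    using N W IJ by auto
  \<comment> \<open>A vanishing integral would give a vanishing norm, as
    \<open>0 powr x = 0\<close>.\<close>
  have p: "enn2real I > 0" "enn2real J > 0"
    using pos enn2real_nonneg[of I] enn2real_nonneg[of J] unfolding eN eW by (auto simp: less_le)
  have I: "I = ennreal (enn2real I)" and J: "J = ennreal (enn2real J)"
    using IJ by (simp_all add: ennreal_enn2real_if)
  show ?thesis
    unfolding eN eW \<theta>_def unfolding real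
    by (rule L1_le_weighted_Lq[OF f _ _ I[unfolded I_def] _ J[unfolded J_def], folded I_def J_def])
       (use q \<alpha> p real in auto)
next
  case PInf
  have "AE x in lebesgue. norm (f x) \<le> enn2real N"
    using AE_norm_le_Lqnorm_infinity[of f]
  proof eventually_elim
    case (elim x)
    then show ?case using fin enn2real_mono[OF elim] by (simp add: N_def PInf top.not_eq_extremum)
  qed
  moreover have "AE x in lebesgue. norm (complex_of_real (norm (x - x0) powr \<alpha>) * f x) \<le> enn2real W"
    using AE_norm_le_Lqnorm_infinity[of "\<lambda>x. complex_of_real (norm (x - x0) powr \<alpha>) * f x"]
  proof eventually_elim
    case (elim x)
    then show ?case using fin enn2real_mono[OF elim] by (simp add: W_def PInf top.not_eq_extremum)
  qed
  ultimately show ?thesis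
    using L1_le_weighted_Linf[of \<alpha> f "enn2real N" x0 "enn2real W"] \<alpha> pos
    by (simp add: PInf conj_exp_def \<theta>_def)
qed (use q in auto)

lemma Lqnorm_2:
  "Lqnorm 2 f = (let I = (\<integral>\<^sup>+x. ennreal ((norm (f x))\<^sup>2) \<partial>lebesgue) in if I = \<infinity> then \<infinity> else ennreal (sqrt (enn2real I)))"
  by (simp add: Lqnorm_def powr_half_sqrt Let_def)

section \<open>Concentration and the lower bound\<close>

text \<open>At most the fraction \<open>\<epsilon>\<^sup>2\<close> of the squared norm lies outside
  \<open>U\<close>, so the rest lies inside, where the integrand is at most
  \<open>c\<^sup>2\<close>.\<close>

lemma eps_concentrated_emeasure:
  fixes f :: "'a::euclidean_space \<Rightarrow> complex"
  assumes conc: "eps_concentrated \<epsilon> U f" and U[measurable]: "U \<in> sets lebesgue" and \<epsilon>: "0 \<le> \<epsilon>"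
    and bound: "AE x in lebesgue. norm (f x) \<le> c"
  shows "ennreal ((1 - \<epsilon>\<^sup>2) * enn2real (Lqnorm 2 f) ^ 2) \<le> emeasure lebesgue U * ennreal (c\<^sup>2)"
proof -
  have [measurable]: "f \<in> borel_measurable lebesgue" and fin: "Lqnorm 2 f \<noteq> \<infinity>"
    and le: "Lqnorm 2 (\<lambda>x. indicator (- U) x * f x) \<le> ennreal \<epsilon> * Lqnorm 2 f"
    using conc unfolding eps_concentrated_def by (blast dest: less_imp_neq)+
  define S where "S = (\<integral>\<^sup>+x. ennreal ((norm (f x))\<^sup>2) \<partial>lebesgue)"
  define A where "A = (\<integral>\<^sup>+x. ennreal ((norm (f x))\<^sup>2) * indicator U x \<partial>lebesgue)"
  define B where "B = (\<integral>\<^sup>+x. ennreal ((norm (indicator (- U) x * f x))\<^sup>2) \<partial>lebesgue)"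
  have Sfin: "S \<noteq> \<infinity>" using fin unfolding Lqnorm_2 S_def Let_def by metis
  have NS: "Lqnorm 2 f = ennreal (sqrt (enn2real S))" using Sfin unfolding Lqnorm_2 S_def Let_def by simp
  have "A + B = (\<integral>\<^sup>+x. ennreal ((norm (f x))\<^sup>2) * indicator U x + ennreal ((norm (indicator (- U) x * f x))\<^sup>2) \<partial>lebesgue)"
    unfolding A_def B_def by (rule nn_integral_add[symmetric]) auto
  also have "\<dots> = S" unfolding S_def by (intro nn_integral_cong) (auto simp: indicator_def)
  finally have AB: "S = A + B" ..
  then have fAB: "A \<noteq> \<infinity>" "B \<noteq> \<infinity>" using Sfin by auto
  then have sAB: "enn2real S = enn2real A + enn2real B"
    unfolding AB by (intro enn2real_plus) (auto simp: less_top)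
  have "ennreal (sqrt (enn2real B)) \<le> ennreal (\<epsilon> * sqrt (enn2real S))"
    using le fAB \<epsilon> unfolding NS unfolding Lqnorm_2 B_def[symmetric] Let_def by (simp add: ennreal_mult)
  then have "sqrt (enn2real B) \<le> \<epsilon> * sqrt (enn2real S)" using \<epsilon> by (subst (asm) ennreal_le_iff) auto
  then have "(sqrt (enn2real B))\<^sup>2 \<le> (\<epsilon> * sqrt (enn2real S))\<^sup>2" by (intro power_mono) auto
  then have "enn2real B \<le> \<epsilon>\<^sup>2 * enn2real S" by (simp add: power_mult_distrib)
  then have "(1 - \<epsilon>\<^sup>2) * enn2real (Lqnorm 2 f) ^ 2 \<le> enn2real A"
    unfolding NS using sAB by (simp add: algebra_simps)
  then have "ennreal ((1 - \<epsilon>\<^sup>2) * enn2real (Lqnorm 2 f) ^ 2) \<le> ennreal (enn2real A)" by (rule ennreal_leI)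
  also have "\<dots> = A" using fAB by (simp add: ennreal_enn2real_if)
  also have "A \<le> (\<integral>\<^sup>+x. ennreal (c\<^sup>2) * indicator U x \<partial>lebesgue)"
    unfolding A_def
  proof (rule nn_integral_mono_AE)
    show "AE x in lebesgue. ennreal ((norm (f x))\<^sup>2) * indicator U x \<le> ennreal (c\<^sup>2) * indicator U x"
      using bound by eventually_elim (auto intro!: mult_right_mono ennreal_leI power_mono)
  qed
  also have "\<dots> = emeasure lebesgue U * ennreal (c\<^sup>2)"
    by (subst nn_integral_cmult_indicator[OF U]) (rule mult.commute)
  finally show ?thesis .
qed

text \<open>Brings the squared L1 bound into the shape of the factors in \<open>Cf_quot\<close>,
  whose exponents carry the factor 2.\<close>

lemma power2_weighted_bound:
  fixes k n w :: real
  assumes "n > 0" "w > 0"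
  shows "(k * n powr (1 - \<theta>) * w powr \<theta>)\<^sup>2 = k\<^sup>2 * n\<^sup>2 * w powr (2 * \<theta>) / n powr (2 * \<theta>)"
proof -
  have "(n powr (1 - \<theta>))\<^sup>2 = n\<^sup>2 / n powr (2 * \<theta>)"
    using assms by (simp add: powr_diff power_divide powr_add power2_eq_square flip: powr_add)
  moreover have "(w powr \<theta>)\<^sup>2 = w powr (2 * \<theta>)"
    by (simp add: power2_eq_square flip: powr_add)
  ultimately show ?thesis by (simp add: power_mult_distrib)
qed

lemma Cf_quot_le:
  fixes f :: "'a::euclidean_space \<Rightarrow> complex"
  assumes T: "T \<in> sets lebesgue" and \<Omega>: "\<Omega> \<in> sets lebesgue"
    and f: "integrable lebesgue f" and F: "integrable lebesgue (fourier f)"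
    and \<epsilon>: "0 \<le> \<epsilon>T" "0 \<le> \<epsilon>\<Omega>" "\<epsilon>T + \<epsilon>\<Omega> \<le> 1"
    and cT: "eps_concentrated \<epsilon>T T f" and c\<Omega>: "eps_concentrated \<epsilon>\<Omega> \<Omega> (fourier f)"
    and q: "1 < q1" "1 < q2"
    and a: "a1 > real DIM('a) / conj_exp q1" "a2 > real DIM('a) / conj_exp q2"
  shows "Cf_quot f tb wb q1 q2 a1 a2 * ennreal ((1 - \<epsilon>T - \<epsilon>\<Omega>)\<^sup>2) \<le> emeasure lebesgue T * emeasure lebesgue \<Omega>"
proof -
  define d where "d = DIM('a)"
  define th1 where "th1 = real d / (a1 * conj_exp q1)"
  define th2 where "th2 = real d / (a2 * conj_exp q2)"
  define Nh1 where "Nh1 = Lqnorm q1 (fourier f)"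
  define Nf2 where "Nf2 = Lqnorm q2 f"
  define W2 where "W2 = Lqnorm q2 (\<lambda>t. complex_of_real (norm (t - tb) powr a2) * f t)"
  define W1 where "W1 = Lqnorm q1 (\<lambda>w. complex_of_real (norm (w - wb) powr a1) * fourier f w)"
  define s where "s = (enn2real (Lqnorm 2 f))\<^sup>2"
  define D where "D = K d a1 q1 * K d a2 q2 * (enn2real Nf2)\<^sup>2 * (enn2real Nh1)\<^sup>2
                  * enn2real W2 powr (2 * th2) * enn2real W1 powr (2 * th1)"
  define E where "E = enn2real Nh1 powr (2 * th1) * enn2real Nf2 powr (2 * th2)"
  define k where "k = (1 - \<epsilon>T - \<epsilon>\<Omega>)\<^sup>2"
  have quot: "Cf_quot f tb wb q1 q2 a1 a2 = (if Nh1 = \<infinity> \<or> Nf2 = \<infinity> \<or> W1 = \<infinity> \<or> W2 = \<infinity> then 0 else ennreal (s\<^sup>2 * E / D))"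
    unfolding Cf_quot_def Let_def Nh1_def Nf2_def W1_def W2_def s_def D_def E_def th1_def th2_def d_def
    by (simp add: mult.assoc)
  show ?thesis
  \<comment> \<open>In the degenerate cases the quotient is 0, by convention for infinite norms and
    by \<open>x / 0 = 0\<close> for \<open>D = 0\<close>. Otherwise \<open>D\<close> nonzero forces
    all four norms to be positive.\<close>
  proof (cases "Nh1 = \<infinity> \<or> Nf2 = \<infinity> \<or> W1 = \<infinity> \<or> W2 = \<infinity> \<or> D = 0")
    case True
    then show ?thesis by (auto simp: quot)
  next
    case False
    then have fin: "Nh1 \<noteq> \<infinity>" "Nf2 \<noteq> \<infinity>" "W1 \<noteq> \<infinity>" "W2 \<noteq> \<infinity>" and "D \<noteq> 0" by auto
    then have "enn2real Nh1 \<noteq> 0" "enn2real Nf2 \<noteq> 0" "enn2real W1 \<noteq> 0" "enn2real W2 \<noteq> 0"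
      by (auto simp: D_def)
    then have pos: "enn2real Nh1 > 0" "enn2real Nf2 > 0" "enn2real W1 > 0" "enn2real W2 > 0"
      by (simp_all add: less_le)
    have D: "D > 0" using \<open>D \<noteq> 0\<close> by (simp add: D_def K_def less_le)
    have E: "E > 0" using pos by (simp add: E_def)
    define A where "A = (LINT x|lebesgue. norm (f x))"
    define B where "B = (LINT w|lebesgue. norm (fourier f w))"
    define a' where "a' = Ktilde d a2 q2 * enn2real Nf2 powr (1 - th2) * enn2real W2 powr th2"
    define b' where "b' = Ktilde d a1 q1 * enn2real Nh1 powr (1 - th1) * enn2real W1 powr th1"
    have AB0: "A \<ge> 0" "B \<ge> 0" by (simp_all add: A_def B_def)
    have "ennreal A \<le> ennreal a'"
      unfolding A_def a'_def Nf2_def W2_def th2_def d_def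
      using f fin pos q a
      by (subst nn_integral_eq_integral[symmetric])
         (auto intro!: L1_le_Lqnorm_weighted simp: Nf2_def W2_def)
    \<comment> \<open>If \<open>a'\<close> were negative, \<open>ennreal a'\<close> would be 0 and
      so would \<open>A\<close>; the squares compare in either case.\<close>
    then have Aa: "A\<^sup>2 \<le> a'\<^sup>2"
      using AB0 by (cases "a' \<ge> 0") (auto simp: ennreal_neg intro: power_mono)
    have "ennreal B \<le> ennreal b'"
      unfolding B_def b'_def Nh1_def W1_def th1_def d_def
      using F fin pos q a
      by (subst nn_integral_eq_integral[symmetric])
         (auto intro!: L1_le_Lqnorm_weighted simp: Nh1_def W1_def)
    then have Bb: "B\<^sup>2 \<le> b'\<^sup>2"
      using AB0 by (cases "b' \<ge> 0") (auto simp: ennreal_neg intro: power_mono)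
    have DE: "a'\<^sup>2 * b'\<^sup>2 = D / E"
      unfolding a'_def b'_def power2_weighted_bound[OF pos(1,3)] power2_weighted_bound[OF pos(2,4)]
      by (simp add: D_def E_def K_def mult_ac)
    \<comment> \<open>By Plancherel the same \<open>s\<close> serves for the concentration of
      \<open>f\<close> and of its transform.\<close>
    have s2: "(enn2real (Lqnorm 2 (fourier f)))\<^sup>2 = s"
      unfolding s_def Lqnorm_2 fourier_plancherel[OF f F] ..
    have T': "ennreal ((1 - \<epsilon>T\<^sup>2) * s) \<le> emeasure lebesgue T * ennreal (b'\<^sup>2)"
    proof -
      have "ennreal ((1 - \<epsilon>T\<^sup>2) * s) \<le> emeasure lebesgue T * ennreal (B\<^sup>2)"
        unfolding s_def by (rule eps_concentrated_emeasure[OF cT T \<epsilon>(1)])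
          (use norm_le_L1_fourier_AE[OF f F] in \<open>simp add: B_def\<close>)
      also have "\<dots> \<le> emeasure lebesgue T * ennreal (b'\<^sup>2)" by (intro mult_left_mono ennreal_leI Bb) simp
      finally show ?thesis .
    qed
    have \<Omega>': "ennreal ((1 - \<epsilon>\<Omega>\<^sup>2) * s) \<le> emeasure lebesgue \<Omega> * ennreal (a'\<^sup>2)"
    proof -
      have "ennreal ((1 - \<epsilon>\<Omega>\<^sup>2) * s) \<le> emeasure lebesgue \<Omega> * ennreal (A\<^sup>2)"
        unfolding s2[symmetric] by (rule eps_concentrated_emeasure[OF c\<Omega> \<Omega> \<epsilon>(2)])
          (use norm_fourier_le_L1[OF f F] in \<open>simp add: A_def\<close>)
      also have "\<dots> \<le> emeasure lebesgue \<Omega> * ennreal (a'\<^sup>2)" by (intro mult_left_mono ennreal_leI Aa) simp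
      finally show ?thesis .
    qed
    have s0: "s \<ge> 0" by (simp add: s_def)
    have sq: "x\<^sup>2 \<le> x" if "0 \<le> x" "x \<le> 1" for x :: real
      using that by (simp add: power2_eq_square mult_left_le)
    have k: "k \<le> (1 - \<epsilon>T\<^sup>2) * (1 - \<epsilon>\<Omega>\<^sup>2)" and eps2: "0 \<le> 1 - \<epsilon>T\<^sup>2" "0 \<le> 1 - \<epsilon>\<Omega>\<^sup>2"
    proof -
      \<comment> \<open>Numbers in the unit interval dominate their squares, so each factor is at
        least \<open>1 - \<epsilon>T - \<epsilon>\<Omega>\<close>, which is nonnegative; the two
        bounds multiply.\<close>
      have "1 - \<epsilon>T - \<epsilon>\<Omega> \<le> 1 - \<epsilon>T\<^sup>2" "1 - \<epsilon>T - \<epsilon>\<Omega> \<le> 1 - \<epsilon>\<Omega>\<^sup>2"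
        using sq[of \<epsilon>T] sq[of \<epsilon>\<Omega>] \<epsilon> by auto
      then show "k \<le> (1 - \<epsilon>T\<^sup>2) * (1 - \<epsilon>\<Omega>\<^sup>2)" "0 \<le> 1 - \<epsilon>T\<^sup>2" "0 \<le> 1 - \<epsilon>\<Omega>\<^sup>2"
        unfolding k_def power2_eq_square[of "1 - \<epsilon>T - \<epsilon>\<Omega>"] using \<epsilon> by (auto intro!: mult_mono)
    qed
    have "ennreal (s\<^sup>2 * E / D) * ennreal k = ennreal (k * s\<^sup>2) * ennreal (E / D)"
      using D E by (simp add: k_def ennreal_mult'[symmetric] mult_ac flip: ennreal_mult)
    also have "\<dots> \<le> ennreal (((1 - \<epsilon>T\<^sup>2) * s) * ((1 - \<epsilon>\<Omega>\<^sup>2) * s)) * ennreal (E / D)"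
      using mult_right_mono[OF k, of "s\<^sup>2"] by (intro mult_right_mono ennreal_leI) (auto simp: power2_eq_square mult_ac)
    also have "\<dots> = ennreal ((1 - \<epsilon>T\<^sup>2) * s) * ennreal ((1 - \<epsilon>\<Omega>\<^sup>2) * s) * ennreal (E / D)"
      using eps2 s0 by (subst ennreal_mult) auto
    also have "\<dots> \<le> (emeasure lebesgue T * ennreal (b'\<^sup>2)) * (emeasure lebesgue \<Omega> * ennreal (a'\<^sup>2)) * ennreal (E / D)"
      by (intro mult_right_mono mult_mono T' \<Omega>') auto
    also have "\<dots> = emeasure lebesgue T * emeasure lebesgue \<Omega> * (ennreal (a'\<^sup>2) * ennreal (b'\<^sup>2) * ennreal (E / D))"
      by (simp only: mult_ac)
    \<comment> \<open>The product of the two squared L1 bounds is \<open>D / E\<close>, the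
      reciprocal of the remaining factor.\<close>
    also have "ennreal (a'\<^sup>2) * ennreal (b'\<^sup>2) * ennreal (E / D) = 1"
      using D E by (simp add: DE flip: ennreal_mult)
    finally show ?thesis using fin by (simp add: quot k_def)
  qed
qed

theorem theorem4p3:
  fixes f :: "'a::euclidean_space \<Rightarrow> complex"
    and T \<Omega> :: "'a set" and \<epsilon>T \<epsilon>\<Omega> :: real
  assumes "T \<in> sets lebesgue" and "\<Omega> \<in> sets lebesgue"
    and "integrable lebesgue f" and "integrable lebesgue (fourier f)"
    and "\<not> (AE x in lebesgue. f x = 0)"
    and "0 \<le> \<epsilon>T" and "\<epsilon>T \<le> 1" and "0 \<le> \<epsilon>\<Omega>" and "\<epsilon>\<Omega> \<le> 1" and "\<epsilon>T + \<epsilon>\<Omega> \<le> 1"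
    and "eps_concentrated \<epsilon>T T f" and "eps_concentrated \<epsilon>\<Omega> \<Omega> (fourier f)"
  shows "emeasure lebesgue T * emeasure lebesgue \<Omega> \<ge> C_f f * ennreal ((1 - \<epsilon>T - \<epsilon>\<Omega>)\<^sup>2)"
  \<comment> \<open>Multiplication by a constant commutes with suprema in \<open>ennreal\<close>, so
    each quotient may be bounded separately.\<close>
  unfolding C_f_def SUP_mult_right_ennreal
  using Cf_quot_le[OF assms(1-4,6,8,10-12)] by (auto intro!: SUP_least simp del: emeasure_completion)

end
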